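(* Let $H$ be a finite-dimensional Hilbert space and let $A_2,\dots,A_n$ and $B_2,\dots,B_n$ be invertible operators in $B(H)$. Assume that $U\in B(H)$ is a bounded operator which satisfies $$|\langle Ux|y\rangle|\le \|x\|\,\|y\|+\|A_2x\|\,\|B_2y\|+\cdots+\|A_nx\|\,\|B_ny\|$$ for all $x,y\in H$. Then the following two conditions are equivalent: (a) $U$ can be split into a sum of $n$ terms $$U=U_1+U_2+\cdots+U_n,\quad U_i\in B(H),$$ such that $$|\langle U_1x|y\rangle|\le \|x\|\,\|y\|,\quad |\langle U_2x|y\rangle|\le \|A_2x\|\,\|B_2y\|,\ \dots,\ |\langle U_nx|y\rangle|\le \|A_nx\|\,\|B_ny\|$$ for all $x,y\in H$. (b) If we set $$K=\{x\underline{\otimes}y:\ \|x\|\,\|y\|+\|A_2x\|\,\|B_2y\|+\cdots+\|A_nx\|\,\|B_ny\|\le 1\}$$ (with $x,y$ ranging over $H$) and $$\Delta=\{T\in B(H):\ \|T\|_1+\|A_2TB_2^*\|_1+\cdots+\|A_nTB_n^*\|_1\le 1\},$$ then $\operatorname{conv}(K)=\Delta$.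
   Context: $B(H)$ is the space of bounded linear operators on $H$. The inner product $\langle\cdot|\cdot\rangle$ is linear in the first variable and conjugate linear in the second. For $x,y\in H$, $x\underline{\otimes}y\in B(H)$ denotes the operator $(x\underline{\otimes}y)(f)=\langle f|y\rangle x$ for $f\in H$ (of rank one if $x$ and $y$ are non-zero). $\|S\|_1=\operatorname{tr}|S|$, with $|S|=(S^*S)^{1/2}$, is the trace class norm of $S$, and $\operatorname{conv}$ denotes the convex hull.
   Formalization: Condition (a) is read as: every U in B(H) satisfying the stated inequality can be split as described; for a single fixed U the equivalence is false (U = 0 always splits, while conv(K) = Δ can fail for n ≥ 3). *)

theory Defs
  imports "HOL-Analysis.Analysis"
begin

text \<open>
  HOL-Analysis only provides real inner product spaces. A complex inner product space is
  axiomatised on top of \<open>real_inner\<close>, whose inner product is the real part of the complex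
  one; hence \<open>norm\<close> is the norm \<open>\<parallel>x\<parallel> = \<langle>x|x\<rangle>\<^sup>1\<^sup>/\<^sup>2\<close>, and positive definiteness is inherited.
  The form is linear in the first and conjugate linear in the second variable.
\<close>

class complex_inner = real_inner +
  fixes scaleC :: "complex \<Rightarrow> 'a \<Rightarrow> 'a" (infixr "*\<^sub>C" 75)
    and cinner :: "'a \<Rightarrow> 'a \<Rightarrow> complex"
  assumes scaleC_add_right: "c *\<^sub>C (x + y) = c *\<^sub>C x + c *\<^sub>C y"
    and scaleC_add_left: "(c + d) *\<^sub>C x = c *\<^sub>C x + d *\<^sub>C x"
    and scaleC_scaleC: "c *\<^sub>C d *\<^sub>C x = (c * d) *\<^sub>C x"
    and scaleC_of_real: "complex_of_real r *\<^sub>C x = r *\<^sub>R x"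
    and cinner_add_left: "cinner (x + y) z = cinner x z + cinner y z"
    and cinner_scaleC_left: "cinner (c *\<^sub>C x) y = c * cinner x y"
    and cinner_commute: "cinner y x = cnj (cinner x y)"
    and Re_cinner: "Re (cinner x y) = inner x y"

text \<open>Completeness is automatic in finite dimension. The zero space is included.\<close>

class findim_hilbert = complex_inner +
  assumes finite_dimensional: "\<exists>E. finite E \<and> (\<forall>x. \<exists>c. x = (\<Sum>e\<in>E. c e *\<^sub>C e))"

text \<open>
  The type \<open>'a \<Rightarrow>\<^sub>L 'a\<close> consists of the bounded \<^emph>\<open>real\<close>-linear operators; \<open>B(H)\<close> is the
  subset of the complex-linear ones.
\<close>

definition bounded_ops :: "('a::complex_inner \<Rightarrow>\<^sub>L 'a) set" where
  "bounded_ops = {T. \<forall>c x. blinfun_apply T (c *\<^sub>C x) = c *\<^sub>C blinfun_apply T x}"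

definition invertible_op :: "('a::complex_inner \<Rightarrow>\<^sub>L 'a) \<Rightarrow> bool" where
  "invertible_op T \<longleftrightarrow> T \<in> bounded_ops \<and>
     (\<exists>S\<in>bounded_ops. S o\<^sub>L T = id_blinfun \<and> T o\<^sub>L S = id_blinfun)"

definition rank_one :: "'a::complex_inner \<Rightarrow> 'a \<Rightarrow> ('a \<Rightarrow>\<^sub>L 'a)" where
  "rank_one x y = Blinfun (\<lambda>f. cinner f y *\<^sub>C x)"

definition adjoint_op :: "('a::findim_hilbert \<Rightarrow>\<^sub>L 'a) \<Rightarrow> ('a \<Rightarrow>\<^sub>L 'a)" where
  "adjoint_op T = (THE S. S \<in> bounded_ops \<and> (\<forall>x y. cinner (T x) y = cinner x (S y)))"

definition positive_op :: "('a::complex_inner \<Rightarrow>\<^sub>L 'a) \<Rightarrow> bool" where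
  "positive_op T \<longleftrightarrow> T \<in> bounded_ops \<and>
     (\<forall>x. Im (cinner (T x) x) = 0 \<and> Re (cinner (T x) x) \<ge> 0)"

text \<open>\<open>|T| = (T\<^sup>*T)\<^sup>1\<^sup>/\<^sup>2\<close>, the unique positive square root of \<open>T\<^sup>*T\<close>.\<close>

definition abs_op :: "('a::findim_hilbert \<Rightarrow>\<^sub>L 'a) \<Rightarrow> ('a \<Rightarrow>\<^sub>L 'a)" where
  "abs_op T = (THE P. positive_op P \<and> P o\<^sub>L P = adjoint_op T o\<^sub>L T)"

definition orthonormal_basis :: "'a::findim_hilbert set \<Rightarrow> bool" where
  "orthonormal_basis E \<longleftrightarrow> finite E \<and>
     (\<forall>e\<in>E. \<forall>f\<in>E. cinner e f = (if e = f then 1 else 0)) \<and>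
     (\<forall>x. \<exists>c. x = (\<Sum>e\<in>E. c e *\<^sub>C e))"

text \<open>The trace does not depend on the choice of the orthonormal basis.\<close>

definition trace_op :: "('a::findim_hilbert \<Rightarrow>\<^sub>L 'a) \<Rightarrow> complex" where
  "trace_op T = (\<Sum>e\<in>(SOME E. orthonormal_basis E). cinner (T e) e)"

text \<open>\<open>trace_op (abs_op T)\<close> is a nonnegative real number; \<open>Re\<close> only adjusts the type.\<close>

definition trace_norm :: "('a::findim_hilbert \<Rightarrow>\<^sub>L 'a) \<Rightarrow> real" where
  "trace_norm T = Re (trace_op (abs_op T))"

lemma norm_scaleC: "norm (c *\<^sub>C x) = cmod c * norm x"
proof -
  have "cinner (c *\<^sub>C x) (c *\<^sub>C x) = (c * cnj c) * cnj (cinner x x)"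
    by (metis (no_types, lifting) cinner_commute cinner_scaleC_left complex_cnj_mult mult.assoc)
  also have "c * cnj c = complex_of_real ((cmod c)\<^sup>2)"
    by (rule complex_norm_square[symmetric])
  finally have "inner (c *\<^sub>C x) (c *\<^sub>C x) = (cmod c)\<^sup>2 * inner x x"
    by (simp add: Re_cinner[symmetric] del: of_real_power)
  then show ?thesis by (simp add: norm_eq_sqrt_inner real_sqrt_mult)
qed

lemma cmod_cinner_le: "cmod (cinner x y) \<le> norm x * norm y"
proof (cases "cinner x y = 0")
  case False
  define a where "a = cnj (cinner x y) / cmod (cinner x y)"
  have "cmod a = 1" using False by (simp add: a_def norm_divide)
  have "cnj (cinner x y) * cinner x y = complex_of_real (cmod (cinner x y)) * cmod (cinner x y)"
    by (metis complex_norm_square mult.commute of_real_power power2_eq_square)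
  then have "cinner (a *\<^sub>C x) y = cmod (cinner x y)"
    using False by (simp add: a_def cinner_scaleC_left)
  then have "cmod (cinner x y) = inner (a *\<^sub>C x) y"
    by (metis Re_cinner Re_complex_of_real)
  also have "\<dots> \<le> norm (a *\<^sub>C x) * norm y" by (rule norm_cauchy_schwarz)
  finally show ?thesis using \<open>cmod a = 1\<close> by (simp add: norm_scaleC)
qed simp

lemma rank_one_apply: "rank_one x y f = cinner f y *\<^sub>C x"
proof -
  have scaleR: "cinner (r *\<^sub>R g) y *\<^sub>C x = r *\<^sub>R (cinner g y *\<^sub>C x)" for r g
    by (metis cinner_scaleC_left scaleC_of_real scaleC_scaleC)
  have "norm (cinner g y *\<^sub>C x) \<le> norm g * (norm y * norm x)" for g
    using mult_right_mono[OF cmod_cinner_le[of g y] norm_ge_zero[of x]]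
    by (simp add: norm_scaleC mult.assoc)
  then have "bounded_linear (\<lambda>f. cinner f y *\<^sub>C x)"
    by (intro bounded_linear_intro[where K = "norm y * norm x"])
       (simp_all add: cinner_add_left scaleC_add_left scaleR)
  then show ?thesis unfolding rank_one_def by (simp add: bounded_linear_Blinfun_apply)
qed

end

(*
  Operators are paired with operators by Re tr (V T), which sends a rank one operator T to
  Re <Vx|y>. The trace norm of A T B* is the maximum of this pairing over the operators V with
  |<Vx|y>| <= ||Ax|| ||By||: the singular value decomposition gives the maximiser for A = B = id,
  and invertibility transports it to the general case. So the sum of trace norms defining Delta is
  the support function of the compact convex set of splittable operators, while the functionals
  bounded by 1 on K are exactly the operators U of the hypothesis. Condition (a) says that every
  such U is splittable, and the equivalence with (b) is the bipolar theorem: a point outside the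
  set of splittable operators, or outside conv(K), is separated from it by a functional. That
  conv(K), and not only its closure, appears is due to Caratheodory's theorem.
*)

theory Submission
  imports Defs
begin

section \<open>Compact convex hulls in finite-dimensional subspaces\<close>

text \<open>All convexity arguments are real. Multiplying x by a unimodular number does not change
  the majorant of |<Ux|y>|, so a bound on Re <Ux|y> for all x, y is the same as a bound on the
  modulus, and real functionals suffice for separation. Since B(H) is only a subset of a type of
  real-linear operators, finite dimension enters through finite real spanning sets and orthonormal
  expansions; compactness of balls, of dominated sets and of conv(K) is derived from these. The
  plain term ||x|| ||y|| is treated as a weighted term with identity weights. It is also what makes
  K compact: it bounds x once y has been normalised. Duality does more than link the two sets:
  nonnegativity and convexity of the sum of trace norms, and the inclusion of K in Delta, are read
  off from the attained maximum of the pairing, without a separate triangle inequality for the trace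
  norm or a computation of |T| for rank one T.\<close>

lemma convex_hull_remove_point:
  fixes S :: "'v::real_vector set"
  assumes "finite S" "affine_dependent S" "x \<in> convex hull S"
  shows "\<exists>a\<in>S. x \<in> convex hull (S - {a})"
proof -
  obtain u where u: "\<forall>v\<in>S. 0 \<le> u v" "sum u S = 1" "(\<Sum>v\<in>S. u v *\<^sub>R v) = x"
    using assms(3) unfolding convex_hull_finite[OF assms(1)] by auto
  obtain w where w: "sum w S = 0" "\<exists>v\<in>S. w v \<noteq> 0" "(\<Sum>v\<in>S. w v *\<^sub>R v) = 0"
    using assms(2) unfolding affine_dependent_explicit_finite[OF assms(1)] by auto
  define P where "P = {v\<in>S. w v > 0}"
  have "P \<noteq> {}"
  proof
    assume "P = {}"
    then have "\<forall>v\<in>S. - w v \<ge> 0" by (auto simp: P_def not_less)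
    moreover have "(\<Sum>v\<in>S. - w v) = 0" using w(1) by (simp add: sum_negf)
    ultimately have "\<forall>v\<in>S. - w v = 0" using sum_nonneg_eq_0_iff[OF assms(1), of "\<lambda>v. - w v"] by blast
    then show False using w(2) by auto
  qed
  moreover have "finite P" using assms(1) by (simp add: P_def)
  \<comment> \<open>The smallest ratio over the positive \<open>w v\<close> is the largest step
    \<open>t\<close> for which all coefficients \<open>u v - t * w v\<close> stay nonnegative; the
    coefficient at \<open>a\<close> is then exactly 0.\<close>
  ultimately obtain a where a: "a \<in> P" and least: "\<And>v. v \<in> P \<Longrightarrow> u a / w a \<le> u v / w v"
    using arg_min_if_finite[of P "\<lambda>v. u v / w v"] by (meson not_le)
  define t where "t = u a / w a"
  have aS: "a \<in> S" and wa: "w a > 0" using a by (auto simp: P_def)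
  have t0: "t \<ge> 0" using u(1) aS wa by (simp add: t_def)
  have nonneg: "u v - t * w v \<ge> 0" if "v \<in> S" for v
  proof (cases "w v > 0")
    case True
    then have "t \<le> u v / w v" using least[of v] that by (simp add: P_def t_def)
    then show ?thesis using True by (simp add: pos_le_divide_eq)
  next
    case False
    then have "t * w v \<le> 0" using t0 by (simp add: mult_nonneg_nonpos)
    then show ?thesis using u(1) that by fastforce
  qed
  have za: "u a - t * w a = 0" using wa by (simp add: t_def)
  have drop: "(\<Sum>v\<in>S - {a}. f v) = sum f S" if "f a = 0" for f :: "'v \<Rightarrow> 'w::ab_group_add"
    using sum.remove[OF assms(1) aS, of f] that by simp
  have "(\<Sum>v\<in>S - {a}. u v - t * w v) = 1"
    using u(2) w(1) by (subst drop) (simp_all add: za sum_subtractf flip: sum_distrib_left)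
  moreover have "(\<Sum>v\<in>S. (u v - t * w v) *\<^sub>R v) = x"
    using u(3) w(3)
    by (simp add: scaleR_left_diff_distrib sum_subtractf flip: scaleR_scaleR scaleR_sum_right)
  then have "(\<Sum>v\<in>S - {a}. (u v - t * w v) *\<^sub>R v) = x"
    by (subst drop) (simp_all add: za)
  ultimately have "x \<in> convex hull (S - {a})"
    unfolding convex_hull_finite[OF finite_Diff[OF assms(1)]] using nonneg
    by (intro CollectI exI[of _ "\<lambda>v. u v - t * w v"]) auto
  then show ?thesis using aS by blast
qed

text \<open>A subset of least cardinality with \<open>x\<close> in its hull is affinely independent.
  Its differences from one of its points are then independent vectors in \<open>span B\<close>, and
  the point itself accounts for the \<open>Suc\<close>.\<close>

lemma caratheodory_span:
  fixes S :: "'v::real_vector set"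
  assumes "finite B" "S \<subseteq> span B" "x \<in> convex hull S"
  shows "\<exists>T. finite T \<and> T \<subseteq> S \<and> card T \<le> Suc (card B) \<and> x \<in> convex hull T"
proof -
  let ?P = "\<lambda>T. finite T \<and> T \<subseteq> S \<and> x \<in> convex hull T"
  have "\<exists>T. ?P T"
  proof -
    obtain T u where "finite T" "T \<subseteq> S" "\<forall>v\<in>T. 0 \<le> u v" "sum u T = 1" "(\<Sum>v\<in>T. u v *\<^sub>R v) = x"
      using assms(3) unfolding convex_hull_explicit by auto
    then show ?thesis using convex_hull_finite by fast
  qed
  then obtain T where T: "?P T" and least: "\<And>T'. ?P T' \<Longrightarrow> card T \<le> card T'"
    using ex_has_least_nat[of ?P _ card] by metis
  have "card T \<le> Suc (card B)"
  proof (rule ccontr)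
    assume big: "\<not> card T \<le> Suc (card B)"
    then obtain a where a: "a \<in> T" by fastforce
    have fin: "finite T" using T by simp
    let ?D = "(\<lambda>x. - a + x) ` (T - {a})"
    have "?D \<subseteq> span B"
      using T a assms(2) by (auto simp: subset_iff intro!: span_diff)
    moreover have "card ?D = card T - 1"
      using fin a by (subst card_image) (auto simp: inj_on_def)
    ultimately have "dependent ?D"
      using independent_span_bound[OF assms(1), of ?D] big by fastforce
    then have "affine_dependent T" using affine_dependent_iff_dependent2[OF a] by simp
    then obtain b where b: "b \<in> T" "x \<in> convex hull (T - {b})"
      using convex_hull_remove_point T by blast
    then have "card T \<le> card (T - {b})" using least[of "T - {b}"] T by blast
    then show False using b(1) fin by (metis card_Diff1_less not_le)
  qed
  then show ?thesis using T by blast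
qed

lemma compact_convex_hull_span:
  fixes S :: "'v::real_normed_vector set"
  assumes "finite B" "S \<subseteq> span B" "compact S"
  shows "compact (convex hull S)"
proof -
  \<comment> \<open>\<open>D m\<close> collects the convex combinations of at most
    \<open>m + 1\<close> points of \<open>S\<close>. Each stage is compact, and by Caratheodory the
    stage \<open>card B\<close> is already the whole hull.\<close>
  define D where "D = rec_nat S (\<lambda>_ C. {(1 - u) *\<^sub>R x + u *\<^sub>R y | x y u. 0 \<le> u \<and> u \<le> 1 \<and> x \<in> S \<and> y \<in> C})"
  have D0: "D 0 = S" by (simp add: D_def)
  have DS: "D (Suc m) = {(1 - u) *\<^sub>R x + u *\<^sub>R y | x y u. 0 \<le> u \<and> u \<le> 1 \<and> x \<in> S \<and> y \<in> D m}" for m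
    by (simp add: D_def)
  have comp: "compact (D m)" for m
    by (induction m) (simp_all only: D0 DS assms(3) compact_convex_combinations)
  have sub: "D m \<subseteq> convex hull S" for m
  proof (induction m)
    case 0
    show ?case by (simp add: D0 hull_subset)
  next
    case (Suc m)
    have "(1 - u) *\<^sub>R x + u *\<^sub>R y \<in> convex hull S" if "0 \<le> u" "u \<le> 1" "x \<in> S" "y \<in> D m" for x y u
      using that Suc hull_inc[OF that(3), of convex] convex_convex_hull[of S]
      by (intro convexD) auto
    then show ?case unfolding DS by blast
  qed
  have sup: "convex hull T \<subseteq> D m" if "finite T" "T \<subseteq> S" "card T \<le> Suc m" for T m
    using that
  proof (induction m arbitrary: T)
    case 0
    then have "T = {} \<or> (\<exists>a. T = {a})"
      by (metis One_nat_def card_0_eq card_1_singletonE le_Suc_eq le_zero_eq)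
    then show ?case using 0 by (auto simp: D0)
  next
    case (Suc m)
    show ?case
    proof (cases "T = {}")
      case False
      then obtain a where a: "a \<in> T" by blast
      define T' where "T' = T - {a}"
      have T': "T = insert a T'" "card T' \<le> Suc m" "T' \<subseteq> S" "finite T'" "a \<in> S"
        using a Suc.prems by (auto simp: T'_def)
      show ?thesis
      proof (cases "T' = {}")
        case True
        \<comment> \<open>The recursion always mixes in a point of \<open>D m\<close>, so a single
          point \<open>a\<close> needs some partner, taken with weight 0.\<close>
        have "D m \<noteq> {}" using Suc.IH[of "{a}"] T'(5) by auto
        then obtain y where "y \<in> D m" by blast
        then have "a \<in> D (Suc m)" unfolding DS using T'(5)
          by (intro CollectI exI[of _ a] exI[of _ y] exI[of _ 0]) auto
        then show ?thesis by (simp add: T'(1) True)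
      next
        case False
        have "convex hull T' \<subseteq> D m" using Suc.IH T' by blast
        then show ?thesis unfolding T'(1) convex_hull_insert[OF False] DS using T'(5)
          by (smt (verit, best) add_diff_cancel_left' mem_Collect_eq subset_iff)
      qed
    qed simp
  qed
  have "convex hull S = D (card B)"
  proof
    show "convex hull S \<subseteq> D (card B)"
      using caratheodory_span[OF assms(1,2)] sup by blast
  qed (rule sub)
  then show ?thesis using comp by simp
qed

section \<open>Finite Minkowski sums\<close>

lemma compact_sum_choices:
  fixes X :: "'i \<Rightarrow> 'v::real_normed_vector set"
  assumes "finite I" "\<And>i. i \<in> I \<Longrightarrow> compact (X i)"
  shows "compact {\<Sum>i\<in>I. f i | f. \<forall>i\<in>I. f i \<in> X i}"
  using assms
proof (induction I rule: finite_induct)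
  case empty
  then show ?case by simp
next
  case (insert j I)
  have "{\<Sum>i\<in>insert j I. f i | f. \<forall>i\<in>insert j I. f i \<in> X i}
      = {x + y | x y. x \<in> X j \<and> y \<in> {\<Sum>i\<in>I. f i | f. \<forall>i\<in>I. f i \<in> X i}}" (is "?L = ?R")
  proof (intro equalityI subsetI)
    fix z assume "z \<in> ?L"
    then show "z \<in> ?R" using insert.hyps by auto
  next
    fix z assume "z \<in> ?R"
    then obtain x f where xf: "x \<in> X j" "\<forall>i\<in>I. f i \<in> X i" "z = x + (\<Sum>i\<in>I. f i)" by blast
    have "(\<Sum>i\<in>insert j I. (f(j := x)) i) = z"
      using insert.hyps xf(3) by (auto intro!: sum.cong)
    moreover have "\<forall>i\<in>insert j I. (f(j := x)) i \<in> X i" using xf insert.hyps by auto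
    ultimately show "z \<in> ?L" by blast
  qed
  then show ?case using insert.IH insert.prems by (simp only:) (blast intro: compact_sums)
qed

lemma convex_sum_choices:
  fixes X :: "'i \<Rightarrow> 'v::real_vector set"
  assumes "\<And>i. i \<in> I \<Longrightarrow> convex (X i)"
  shows "convex {\<Sum>i\<in>I. f i | f. \<forall>i\<in>I. f i \<in> X i}"
proof (rule convexI)
  fix x y and u v :: real
  assume "x \<in> {\<Sum>i\<in>I. f i | f. \<forall>i\<in>I. f i \<in> X i}" "y \<in> {\<Sum>i\<in>I. f i | f. \<forall>i\<in>I. f i \<in> X i}"
    and uv: "0 \<le> u" "0 \<le> v" "u + v = 1"
  then obtain f g where fg: "x = (\<Sum>i\<in>I. f i)" "\<forall>i\<in>I. f i \<in> X i" "y = (\<Sum>i\<in>I. g i)" "\<forall>i\<in>I. g i \<in> X i"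
    by blast
  have "u *\<^sub>R x + v *\<^sub>R y = (\<Sum>i\<in>I. u *\<^sub>R f i + v *\<^sub>R g i)"
    by (simp add: fg sum.distrib scaleR_sum_right)
  moreover have "\<forall>i\<in>I. u *\<^sub>R f i + v *\<^sub>R g i \<in> X i"
    using fg uv assms by (auto intro: convexD)
  ultimately show "u *\<^sub>R x + v *\<^sub>R y \<in> {\<Sum>i\<in>I. f i | f. \<forall>i\<in>I. f i \<in> X i}" by blast
qed

section \<open>Complex inner product spaces\<close>

lemma cinner_add_right: "cinner x (y + z) = cinner x y + cinner x z"
  by (metis cinner_add_left cinner_commute complex_cnj_add)

lemma cinner_scaleC_right: "cinner x (c *\<^sub>C y) = cnj c * cinner x y"
  by (metis cinner_commute cinner_scaleC_left complex_cnj_mult)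

lemma cinner_zero_left [simp]: "cinner 0 y = 0"
  by (metis add_cancel_right_right cinner_add_left)

lemma cinner_zero_right [simp]: "cinner x 0 = 0"
  by (metis add_cancel_right_right cinner_add_right)

lemma scaleR_scaleC: "r *\<^sub>R x = complex_of_real r *\<^sub>C x"
  by (simp add: scaleC_of_real)

lemma scaleC_one [simp]: "1 *\<^sub>C x = x"
  using scaleC_of_real[of 1 x] by simp

lemma scaleC_zero_left [simp]: "0 *\<^sub>C x = 0"
  using scaleC_of_real[of 0 x] by simp

lemma scaleC_zero_right [simp]: "c *\<^sub>C (0::'a::complex_inner) = 0"
  by (metis add_cancel_right_right scaleC_add_right)

lemma cinner_minus_left: "cinner (- x) y = - cinner x y"
  by (metis add.right_inverse cinner_add_left cinner_zero_left eq_neg_iff_add_eq_0 add.commute)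

lemma cinner_diff_left: "cinner (x - z) y = cinner x y - cinner z y"
  by (metis (no_types) cinner_add_left cinner_minus_left diff_conv_add_uminus)

lemma cinner_sum_left: "cinner (\<Sum>i\<in>I. f i) y = (\<Sum>i\<in>I. cinner (f i) y)"
  by (induction I rule: infinite_finite_induct) (simp_all add: cinner_add_left)

lemma cinner_sum_right: "cinner x (\<Sum>i\<in>I. f i) = (\<Sum>i\<in>I. cinner x (f i))"
  by (induction I rule: infinite_finite_induct) (simp_all add: cinner_add_right)

lemma cinner_self: "cinner x x = complex_of_real ((norm x)\<^sup>2)"
proof (rule complex_eqI)
  show "Re (cinner x x) = Re (complex_of_real ((norm x)\<^sup>2))"
    by (simp add: Re_cinner power2_norm_eq_inner del: of_real_power)
  have "Im (cinner x x) = - Im (cinner x x)"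
    using arg_cong[OF cinner_commute[of x x], of Im] by simp
  then show "Im (cinner x x) = Im (complex_of_real ((norm x)\<^sup>2))"
    by (simp del: of_real_power)
qed

lemma bounded_linear_scaleC_left: "bounded_linear (\<lambda>c. c *\<^sub>C x)"
  by (rule bounded_linear_intro[where K = "norm x"])
     (auto simp: scaleC_add_left norm_scaleC scaleR_scaleC scaleC_scaleC scaleR_conv_of_real)

text \<open>Complex-linearity turns a bound on the real part into a bound on the modulus.\<close>

lemma phase_rotation:
  obtains a where "cmod a = 1" "inner (a *\<^sub>C x) y = cmod (cinner x y)"
proof (cases "cinner x y = 0")
  case True
  then show ?thesis using that[of 1] by (simp flip: Re_cinner)
next
  case False
  define a where "a = cnj (cinner x y) / cmod (cinner x y)"
  have "cmod a = 1" using False by (simp add: a_def norm_divide)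
  have "cnj (cinner x y) * cinner x y = complex_of_real (cmod (cinner x y)) * cmod (cinner x y)"
    by (metis complex_norm_square mult.commute of_real_power power2_eq_square)
  then have "cinner (a *\<^sub>C x) y = cmod (cinner x y)"
    using False by (simp add: a_def cinner_scaleC_left)
  then have "inner (a *\<^sub>C x) y = cmod (cinner x y)"
    by (metis Re_cinner Re_complex_of_real)
  then show ?thesis using that \<open>cmod a = 1\<close> by blast
qed

lemma cinner_eqI:
  assumes "\<And>z. cinner x z = cinner y z"
  shows "x = y"
proof -
  have "inner (x - y) (x - y) = 0"
    using assms[of "x - y"] by (simp flip: Re_cinner add: cinner_diff_left)
  then show ?thesis by simp
qed

section \<open>Spectral theorem and trace norm\<close>

definition orthonormal :: "'a::complex_inner set \<Rightarrow> bool" where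
  "orthonormal E \<longleftrightarrow> (\<forall>e\<in>E. \<forall>f\<in>E. cinner e f = (if e = f then 1 else 0))"

lemma orthonormal_norm:
  assumes "orthonormal E" "e \<in> E"
  shows "norm e = 1"
proof -
  have "complex_of_real ((norm e)\<^sup>2) = 1"
    using assms cinner_self[of e] by (simp add: orthonormal_def)
  then have "(norm e)\<^sup>2 = 1" using of_real_eq_1_iff by blast
  then show ?thesis by (simp add: power2_eq_1_iff) (metis norm_ge_zero not_one_le_zero neg_0_le_iff_le)
qed

lemma orthonormal_independent:
  assumes "orthonormal E"
  shows "independent E"
proof (rule pairwise_orthogonal_independent)
  show "pairwise orthogonal E"
    using assms by (auto simp: pairwise_def orthogonal_def orthonormal_def simp flip: Re_cinner)
  show "0 \<notin> E" using orthonormal_norm[OF assms, of 0] by auto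
qed

text \<open>Real spans require the multiples by \<i> of a complex spanning set. The resulting finite
  real dimension bounds the size of orthonormal sets.\<close>

lemma finite_real_span: "\<exists>B::'a::findim_hilbert set. finite B \<and> span B = UNIV"
proof -
  obtain E :: "'a set" where E: "finite E" "\<And>x. \<exists>c. x = (\<Sum>e\<in>E. c e *\<^sub>C e)"
    using finite_dimensional by blast
  let ?B = "E \<union> (*\<^sub>C) \<i> ` E"
  have "x \<in> span ?B" for x
  proof -
    obtain c where "x = (\<Sum>e\<in>E. c e *\<^sub>C e)" using E(2) by blast
    moreover have "c e *\<^sub>C e = Re (c e) *\<^sub>R e + Im (c e) *\<^sub>R (\<i> *\<^sub>C e)" for e
      by (simp add: scaleR_scaleC scaleC_scaleC mult.commute flip: scaleC_add_left complex_eq)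
    moreover have "Re (c e) *\<^sub>R e + Im (c e) *\<^sub>R (\<i> *\<^sub>C e) \<in> span ?B" if "e \<in> E" for e
      using that by (intro span_add span_scale span_base) auto
    ultimately show ?thesis by (simp add: span_sum)
  qed
  then show ?thesis using E(1) by (intro exI[of _ ?B]) auto
qed

text \<open>Orthonormal sets are linearly independent over the reals, so their cardinality is
  bounded and a largest one exists among those satisfying \<open>P\<close>. A trivial
  \<open>P\<close> yields orthonormal bases; \<open>P\<close> for "eigenvector" starts the spectral
  theorem.\<close>

lemma maximal_orthonormal:
  fixes P :: "'a::findim_hilbert \<Rightarrow> bool"
  obtains E where "finite E" "orthonormal E" "\<And>e. e \<in> E \<Longrightarrow> P e"
    "\<And>v. norm v = 1 \<Longrightarrow> P v \<Longrightarrow> \<exists>e\<in>E. cinner v e \<noteq> 0"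
proof -
  obtain B :: "'a set" where B: "finite B" "span B = UNIV" using finite_real_span by blast
  have bound: "finite E \<and> card E \<le> card B" if "orthonormal E" for E :: "'a set"
    using independent_span_bound[OF B(1), of E] orthonormal_independent[OF that] B(2) by simp
  let ?Q = "\<lambda>E. orthonormal E \<and> (\<forall>e\<in>E. P e)"
  have "?Q {}" by (simp add: orthonormal_def)
  moreover have "\<forall>E. ?Q E \<longrightarrow> card E < Suc (card B)" using bound by (simp add: less_Suc_eq_le)
  ultimately obtain E where E: "?Q E" and greatest: "\<And>F. ?Q F \<Longrightarrow> card F \<le> card E"
    using ex_has_greatest_nat[of ?Q "{}" card "Suc (card B)"] by blast
  have fin: "finite E" using bound E by blast
  have "\<exists>e\<in>E. cinner v e \<noteq> 0" if "norm v = 1" "P v" for v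
  proof (rule ccontr)
    assume "\<not> ?thesis"
    then have ve: "\<forall>e\<in>E. cinner v e = 0 \<and> cinner e v = 0"
      by (metis cinner_commute complex_cnj_zero)
    have vv: "cinner v v = 1" using that(1) by (simp add: cinner_self)
    then have "v \<notin> E" using ve by auto
    moreover have "?Q (insert v E)" using E ve vv that(2) \<open>v \<notin> E\<close> by (auto simp: orthonormal_def)
    ultimately show False using greatest[of "insert v E"] fin by simp
  qed
  then show ?thesis using that fin E by blast
qed

lemma orthonormal_residual:
  assumes "finite E" "orthonormal E" "f \<in> E"
  shows "cinner (x - (\<Sum>e\<in>E. cinner x e *\<^sub>C e)) f = 0"
proof -
  have "(\<Sum>e\<in>E. cinner x e * cinner e f) = (\<Sum>e\<in>E. if e = f then cinner x e else 0)"
    using assms by (intro sum.cong) (auto simp: orthonormal_def)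
  then show ?thesis
    using assms by (simp add: cinner_diff_left cinner_sum_left cinner_scaleC_left)
qed

lemma orthonormal_basisI:
  assumes "finite E" "orthonormal E" "\<And>v. norm v = 1 \<Longrightarrow> \<exists>e\<in>E. cinner v e \<noteq> 0"
  shows "orthonormal_basis E"
proof -
  have "\<exists>c. x = (\<Sum>e\<in>E. c e *\<^sub>C e)" for x
  proof -
    define z where "z = x - (\<Sum>e\<in>E. cinner x e *\<^sub>C e)"
    have orth: "cinner z e = 0" if "e \<in> E" for e
      using orthonormal_residual[OF assms(1,2) that] by (simp add: z_def)
    have "z = 0"
    proof (rule ccontr)
      assume "z \<noteq> 0"
      then have "norm ((1 / norm z) *\<^sub>R z) = 1" by simp
      then obtain e where "e \<in> E" "cinner ((1 / norm z) *\<^sub>R z) e \<noteq> 0" using assms(3) by blast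
      then show False using orth by (simp add: scaleR_scaleC cinner_scaleC_left)
    qed
    then show ?thesis by (auto simp: z_def)
  qed
  then show ?thesis using assms unfolding orthonormal_basis_def orthonormal_def by blast
qed

text \<open>The very choice term occurring in \<open>trace_op\<close>, so that traces unfold to sums
  over \<open>onb\<close>.\<close>

definition onb :: "'a::findim_hilbert set" where
  "onb = (SOME E. orthonormal_basis E)"

lemma orthonormal_basis_onb: "orthonormal_basis onb"
proof -
  have "\<exists>E::'a set. orthonormal_basis E"
  proof (rule maximal_orthonormal[of "\<lambda>_. True"])
    fix E :: "'a set"
    assume "finite E" "orthonormal E" "\<And>v. norm v = 1 \<Longrightarrow> True \<Longrightarrow> \<exists>e\<in>E. cinner v e \<noteq> 0"
    then show ?thesis by (intro exI[of _ E] orthonormal_basisI) auto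
  qed
  then show ?thesis unfolding onb_def by (rule someI_ex)
qed

lemma orthonormal_basisD:
  assumes "orthonormal_basis E"
  shows "finite E" "orthonormal E"
  using assms by (auto simp: orthonormal_basis_def orthonormal_def)

lemma orthonormal_expansion:
  assumes "orthonormal_basis E"
  shows "x = (\<Sum>e\<in>E. cinner x e *\<^sub>C e)"
proof -
  note E = orthonormal_basisD[OF assms]
  let ?z = "x - (\<Sum>e\<in>E. cinner x e *\<^sub>C e)"
  \<comment> \<open>The residual is a combination of elements of \<open>E\<close> and orthogonal to
    all of them, hence orthogonal to itself.\<close>
  obtain c where c: "?z = (\<Sum>e\<in>E. c e *\<^sub>C e)" using assms unfolding orthonormal_basis_def by blast
  have "cinner ?z ?z = (\<Sum>e\<in>E. cnj (c e) * cinner ?z e)"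
    by (subst (2) c) (simp add: cinner_sum_right cinner_scaleC_right)
  also have "\<dots> = 0" using orthonormal_residual[OF E] by simp
  finally have "?z = 0" by (simp add: cinner_self)
  then show ?thesis by simp
qed

lemma parseval:
  assumes "orthonormal_basis E"
  shows "cinner x y = (\<Sum>e\<in>E. cinner x e * cinner e y)"
proof -
  have "cinner x y = cinner (\<Sum>e\<in>E. cinner x e *\<^sub>C e) y"
    by (simp flip: orthonormal_expansion[OF assms])
  then show ?thesis by (simp add: cinner_sum_left cinner_scaleC_left)
qed

section \<open>Compactness in finite dimension\<close>

lemma compact_closed_in_compact:
  fixes S C :: "'t::t2_space set"
  assumes "compact C" "S \<subseteq> C" "closed S"
  shows "compact S"
  using compact_Int_closed[OF assms(1,3)] Int_absorb1[OF assms(2)] by simp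

text \<open>The ball is closed and lies in a polydisc: its coordinates in \<open>onb\<close> have
  modulus at most \<open>r\<close>, and a finite sum of compact discs is compact.\<close>

lemma compact_cball_findim: "compact (cball (0::'a::findim_hilbert) r)"
proof -
  define X :: "'a \<Rightarrow> 'a set" where "X e = (\<lambda>c. c *\<^sub>C e) ` cball 0 r" for e
  have "compact (X e)" for e
    unfolding X_def
    by (intro compact_continuous_image linear_continuous_on bounded_linear_scaleC_left) simp
  then have "compact {\<Sum>e\<in>onb. f e | f. \<forall>e\<in>onb. f e \<in> X e}"
    using orthonormal_basisD(1)[OF orthonormal_basis_onb] by (intro compact_sum_choices)
  moreover have "cball 0 r \<subseteq> {\<Sum>e\<in>onb. f e | f. \<forall>e\<in>onb. f e \<in> X e}"
  proof
    fix x :: 'a assume "x \<in> cball 0 r"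
    then have "cmod (cinner x e) \<le> r" if "e \<in> onb" for e
      using cmod_cinner_le[of x e]
        orthonormal_norm[OF orthonormal_basisD(2)[OF orthonormal_basis_onb] that] by simp
    then show "x \<in> {\<Sum>e\<in>onb. f e | f. \<forall>e\<in>onb. f e \<in> X e}"
      using orthonormal_expansion[OF orthonormal_basis_onb, of x]
      by (intro CollectI exI[of _ "\<lambda>e. cinner x e *\<^sub>C e"]) (auto simp: X_def)
  qed
  ultimately show ?thesis using closed_cball by (rule compact_closed_in_compact)
qed

lemma compact_findim:
  fixes S :: "'a::findim_hilbert set"
  assumes "closed S" "bounded S"
  shows "compact S"
proof -
  obtain r where "S \<subseteq> cball 0 r" using assms(2) by (auto simp: bounded_iff subset_iff)
  with compact_cball_findim show ?thesis using assms(1) by (rule compact_closed_in_compact)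
qed

section \<open>First-order conditions and the spectral theorem\<close>

lemma first_order_nonneg:
  fixes a b :: real
  assumes "\<And>t. 0 < t \<Longrightarrow> t \<le> 1 \<Longrightarrow> 0 \<le> 2 * t * a + t\<^sup>2 * b"
  shows "0 \<le> a"
proof (rule ccontr)
  assume a: "\<not> 0 \<le> a"
  have b: "b > 0" using assms[of 1] a by simp
  \<comment> \<open>For this \<open>t\<close> the bracket in t * (2 * a + t * b) is at most
    \<open>a\<close>, hence negative.\<close>
  define t where "t = min 1 (- a / b)"
  have t: "0 < t" "t \<le> 1" "t * b \<le> - a"
    using a b by (auto simp: t_def min_def field_simps)
  have "t * (2 * a + t * b) < 0" using t a by (intro mult_pos_neg) auto
  then show False using assms[OF t(1,2)] by (simp add: algebra_simps power2_eq_square)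
qed

text \<open>The orthogonal complement \<open>M\<close> of a maximal orthonormal set of eigenvectors
  is invariant under \<open>T\<close>. If it contained a unit vector, a maximiser of <Tx|x> on its
  unit sphere would be one more eigenvector, orthogonal to all the others.\<close>

lemma spectral_theorem:
  fixes T :: "'a::findim_hilbert \<Rightarrow>\<^sub>L 'a"
  assumes sa: "\<And>x y. cinner (T x) y = cinner x (T y)"
  obtains E l where "orthonormal_basis E" "\<And>e. e \<in> E \<Longrightarrow> T e = l e *\<^sub>R e"
proof -
  obtain E where E: "finite E" "orthonormal E" "\<And>e. e \<in> E \<Longrightarrow> \<exists>l. T e = l *\<^sub>R e"
    and max: "\<And>v. norm v = 1 \<Longrightarrow> \<exists>l. T v = l *\<^sub>R v \<Longrightarrow> \<exists>e\<in>E. cinner v e \<noteq> 0"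
    using maximal_orthonormal[of "\<lambda>v. \<exists>l. T v = l *\<^sub>R v"] by blast
  define M where "M = {x. \<forall>e\<in>E. cinner x e = 0}"
  have M_add: "x + y \<in> M" if "x \<in> M" "y \<in> M" for x y
    using that by (simp add: M_def cinner_add_left)
  have M_scale: "r *\<^sub>R x \<in> M" if "x \<in> M" for x r
    using that by (simp add: M_def cinner_scaleC_left scaleR_scaleC)
  have M_inv: "T x \<in> M" if "x \<in> M" for x
    unfolding M_def
  proof safe
    fix e assume "e \<in> E"
    then show "cinner (T x) e = 0"
      using E(3)[of e] that by (auto simp: sa M_def scaleR_scaleC cinner_scaleC_right)
  qed
  have "M \<inter> sphere 0 1 = {}"
  proof (rule ccontr)
    assume ne: "M \<inter> sphere 0 1 \<noteq> {}"
    have "closed M"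
    proof -
      \<comment> \<open>Pairing with \<open>e\<close> and with \<i> times \<open>e\<close> gives the
        real and the imaginary part of \<open>cinner x e\<close>, so \<open>M\<close> is an
        intersection of real hyperplanes.\<close>
      have "M = (\<Inter>e\<in>E. {x. inner x e = 0} \<inter> {x. inner x (\<i> *\<^sub>C e) = 0})"
        by (auto simp: M_def cinner_scaleC_right complex_eq_iff simp flip: Re_cinner)
      then show ?thesis
        by (auto intro!: closed_INT closed_Int closed_Collect_eq continuous_intros)
    qed
    moreover have "closed {x::'a. norm x = 1}" by (intro closed_Collect_eq continuous_intros)
    then have "closed (sphere 0 1 :: 'a set)" by (simp add: sphere_def dist_norm)
    ultimately have "compact (M \<inter> sphere 0 1)"
      by (intro compact_findim closed_Int) (auto simp: bounded_iff)
    moreover have "continuous_on (M \<inter> sphere 0 1) (\<lambda>x. inner (T x) x)"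
      by (intro continuous_intros)
    ultimately obtain v where v: "v \<in> M" "norm v = 1"
      and sup: "\<And>x. x \<in> M \<Longrightarrow> norm x = 1 \<Longrightarrow> inner (T x) x \<le> inner (T v) v"
      using continuous_attains_sup[OF _ ne] by force
    define m where "m = inner (T v) v"
    \<comment> \<open>By homogeneity the maximum on the sphere becomes a nonnegative quadratic form
      on all of \<open>M\<close>. It vanishes at \<open>v\<close>, so its derivative there is
      nonnegative in every direction of \<open>M\<close>.\<close>
    have quad: "0 \<le> m * inner x x - inner (T x) x" if x: "x \<in> M" for x
    proof (cases "x = 0")
      case False
      let ?u = "(1 / norm x) *\<^sub>R x"
      have "inner (T ?u) ?u \<le> m" using sup[of ?u] M_scale[OF x] False by (simp add: m_def)
      then have "inner (T x) x / (norm x)\<^sup>2 \<le> m"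
        by (simp add: blinfun.scaleR_right power2_eq_square)
      then show ?thesis using False by (simp add: power2_norm_eq_inner divide_le_eq)
    qed simp
    have sym: "inner (T x) y = inner (T y) x" for x y
      by (metis Re_cinner inner_commute sa)
    have stat: "0 \<le> m * inner v w - inner (T v) w" if w: "w \<in> M" for w
    proof (rule first_order_nonneg)
      fix t :: real
      have "0 \<le> m * inner (v + t *\<^sub>R w) (v + t *\<^sub>R w) - inner (T (v + t *\<^sub>R w)) (v + t *\<^sub>R w)"
        using v w by (intro quad M_add M_scale)
      also have "\<dots> = (m * inner v v - inner (T v) v) + 2 * t * (m * inner v w - inner (T v) w)
          + t\<^sup>2 * (m * inner w w - inner (T w) w)"
        using sym[of v w] inner_commute[of v w]
        by (simp add: blinfun.add_right blinfun.scaleR_right inner_add_left inner_add_right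
            algebra_simps power2_eq_square)
      finally show "0 \<le> 2 * t * (m * inner v w - inner (T v) w) + t\<^sup>2 * (m * inner w w - inner (T w) w)"
        using v(2) by (simp add: m_def flip: power2_norm_eq_inner)
    qed
    define w where "w = T v - m *\<^sub>R v"
    have "w \<in> M" using M_add[OF M_inv[OF v(1)] M_scale[OF v(1), of "- m"]] by (simp add: w_def)
    \<comment> \<open>For the direction \<open>w\<close> = T v - m v the derivative is -||w||^2,
      which forces \<open>w\<close> to vanish.\<close>
    then have "0 \<le> - inner w w" using stat[of w]
      by (simp add: w_def inner_diff_left algebra_simps)
    then have "w = 0" by (metis inner_ge_zero inner_eq_zero_iff neg_0_le_iff_le order_antisym)
    then have "T v = m *\<^sub>R v" by (simp add: w_def)
    then show False using max[OF v(2)] v(1) by (auto simp: M_def)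
  qed
  then have "orthonormal_basis E"
    using E by (intro orthonormal_basisI) (auto simp: M_def)
  moreover obtain l where "\<And>e. e \<in> E \<Longrightarrow> T e = l e *\<^sub>R e" using E(3) by metis
  ultimately show ?thesis using that by blast
qed

section \<open>Complex-linear operators, adjoints and absolute values\<close>

lemma bounded_opsD: "T \<in> bounded_ops \<Longrightarrow> T (c *\<^sub>C x) = c *\<^sub>C T x"
  by (simp add: bounded_ops_def)

lemma bounded_ops_zero [simp]: "0 \<in> bounded_ops"
  and bounded_ops_id [simp]: "id_blinfun \<in> bounded_ops"
  and bounded_ops_rank_one [simp]: "rank_one x y \<in> bounded_ops"
  by (simp_all add: bounded_ops_def rank_one_apply cinner_scaleC_left scaleC_scaleC)

lemma bounded_ops_add [intro]: "S \<in> bounded_ops \<Longrightarrow> T \<in> bounded_ops \<Longrightarrow> S + T \<in> bounded_ops"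
  by (simp add: bounded_ops_def blinfun.add_left scaleC_add_right)

lemma bounded_ops_compose [intro]:
  "S \<in> bounded_ops \<Longrightarrow> T \<in> bounded_ops \<Longrightarrow> S o\<^sub>L T \<in> bounded_ops"
  by (simp add: bounded_ops_def)

lemma bounded_ops_scaleR [intro]: "T \<in> bounded_ops \<Longrightarrow> r *\<^sub>R T \<in> bounded_ops"
  by (simp add: bounded_ops_def blinfun.scaleR_left scaleR_scaleC scaleC_scaleC mult.commute)

lemma bounded_ops_diff [intro]: "S \<in> bounded_ops \<Longrightarrow> T \<in> bounded_ops \<Longrightarrow> S - T \<in> bounded_ops"
  using bounded_ops_add[OF _ bounded_ops_scaleR[of T "-1"], of S] by simp

lemma bounded_ops_sum [intro]: "(\<And>i. i \<in> I \<Longrightarrow> T i \<in> bounded_ops) \<Longrightarrow> (\<Sum>i\<in>I. T i) \<in> bounded_ops"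
  by (induction I rule: infinite_finite_induct) auto

lemma blinfun_sum_apply: "blinfun_apply (\<Sum>i\<in>I. T i) x = (\<Sum>i\<in>I. T i x)"
  by (induction I rule: infinite_finite_induct) (simp_all add: blinfun.add_left)

lemma bounded_ops_expansion_apply:
  assumes "orthonormal_basis E" "T \<in> bounded_ops"
  shows "T x = (\<Sum>e\<in>E. cinner x e *\<^sub>C T e)"
proof -
  have "T x = T (\<Sum>e\<in>E. cinner x e *\<^sub>C e)" by (simp flip: orthonormal_expansion[OF assms(1)])
  then show ?thesis by (simp add: blinfun.sum_right bounded_opsD[OF assms(2)])
qed

lemma bounded_ops_eqI:
  assumes "orthonormal_basis E" "S \<in> bounded_ops" "T \<in> bounded_ops" "\<And>e. e \<in> E \<Longrightarrow> S e = T e"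
  shows "S = T"
proof (rule blinfun_eqI)
  fix x
  show "S x = T x"
    unfolding bounded_ops_expansion_apply[OF assms(1,2), of x] bounded_ops_expansion_apply[OF assms(1,3), of x]
    using assms(4) by simp
qed

lemma bounded_ops_expansion:
  assumes "orthonormal_basis E" "T \<in> bounded_ops"
  shows "T = (\<Sum>e\<in>E. rank_one (T e) e)"
  by (rule blinfun_eqI)
    (simp add: blinfun_sum_apply rank_one_apply flip: bounded_ops_expansion_apply[OF assms])

text \<open>The sum over \<open>onb\<close> of the operators \<open>rank_one e (T e)\<close> is an
  explicit adjoint. Nondegeneracy of the inner product makes it the only one, which gives the
  definite description its meaning.\<close>

lemma adjoint_op:
  assumes T: "T \<in> bounded_ops"
  shows adjoint_op_bounded: "adjoint_op T \<in> bounded_ops"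
    and cinner_adjoint_op: "cinner (T x) y = cinner x (adjoint_op T y)"
proof -
  let ?S = "\<Sum>e\<in>onb. rank_one e (T e)"
  have adj: "cinner (T x) y = cinner x (?S y)" for x y
  proof -
    have "cinner (T x) y = (\<Sum>e\<in>onb. cinner x e * cinner (T e) y)"
      by (subst bounded_ops_expansion_apply[OF orthonormal_basis_onb T])
        (simp add: cinner_sum_left cinner_scaleC_left)
    also have "\<dots> = cinner x (?S y)"
      by (simp add: blinfun_sum_apply rank_one_apply cinner_sum_right cinner_scaleC_right mult.commute
          flip: cinner_commute[of _ y])
    finally show ?thesis .
  qed
  have "?S \<in> bounded_ops" by auto
  moreover have "R = ?S" if "\<forall>x y. cinner (T x) y = cinner x (R y)" for R :: "'a \<Rightarrow>\<^sub>L 'a"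
  proof (rule blinfun_eqI)
    fix y
    show "R y = ?S y"
    proof (rule cinner_eqI)
      fix z
      have "cinner z (R y) = cinner z (?S y)" using that adj by simp
      then show "cinner (R y) z = cinner (?S y) z"
        using cinner_commute[of z "R y"] cinner_commute[of z "?S y"] by simp
    qed
  qed
  ultimately have "\<exists>!S. S \<in> bounded_ops \<and> (\<forall>x y. cinner (T x) y = cinner x (S y))" using adj by blast
  then have "adjoint_op T \<in> bounded_ops \<and> (\<forall>x y. cinner (T x) y = cinner x (adjoint_op T y))"
    unfolding adjoint_op_def by (rule theI')
  then show "adjoint_op T \<in> bounded_ops" "cinner (T x) y = cinner x (adjoint_op T y)"
    by blast+
qed

lemma inner_adjoint_op: "T \<in> bounded_ops \<Longrightarrow> inner (T x) y = inner x (adjoint_op T y)"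
  by (metis Re_cinner cinner_adjoint_op)

lemma positive_op_selfadjoint:
  assumes "positive_op Q"
  shows "cinner (Q x) y = cinner x (Q y)"
proof -
  have Q: "Q \<in> bounded_ops" and im: "Im (cinner (Q z) z) = 0" for z
    using assms by (auto simp: positive_op_def)
  have "Im (cinner (Q (x + c *\<^sub>C y)) (x + c *\<^sub>C y)) = 0" for c by (rule im)
  \<comment> \<open>Polarisation: the diagonal terms are real, so only the cross terms remain.
    \<open>c\<close> = 1 compares the imaginary parts of the two inner products, \<open>c\<close> =
    \<i> their real parts.\<close>
  then have *: "Im (cnj c * cinner (Q x) y + c * cinner (Q y) x) = 0" for c
    using im[of x] im[of y]
    by (simp add: blinfun.add_right bounded_opsD[OF Q] cinner_add_left cinner_add_right
        cinner_scaleC_left cinner_scaleC_right algebra_simps)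
  have "cinner (Q x) y = cnj (cinner (Q y) x)"
    using *[of 1] *[of \<i>] by (simp add: complex_eq_iff)
  then show ?thesis by (metis cinner_commute)
qed

text \<open>The square roots of \<open>T\<^sup>*T\<close> share its eigenvectors: for \<open>\<sigma> > 0\<close> the factor \<open>Q + \<sigma>\<close> of
  \<open>Q\<^sup>2 - \<sigma>\<^sup>2\<close> is injective.\<close>

lemma positive_op_sqrt_eigen:
  assumes Q: "positive_op Q" and e: "Q (Q e) = s\<^sup>2 *\<^sub>R e" and s: "s \<ge> 0"
  shows "Q e = s *\<^sub>R e"
proof (cases "s = 0")
  case True
  have "cinner (Q e) (Q e) = 0"
    using positive_op_selfadjoint[OF Q, of e "Q e"] e True by simp
  then show ?thesis using True by (simp add: cinner_self)
next
  case False
  define z where "z = Q e - s *\<^sub>R e"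
  have "Q z = - s *\<^sub>R z"
    by (simp add: z_def blinfun.diff_right blinfun.scaleR_right e power2_eq_square algebra_simps)
  then have "inner (Q z) z = - s * inner z z" by simp
  moreover have "inner (Q z) z \<ge> 0" using Q by (simp add: positive_op_def flip: Re_cinner)
  ultimately have "s * inner z z \<le> 0" by simp
  then have "z = 0" using s False by (simp add: mult_le_0_iff)
      (metis inner_eq_zero_iff inner_ge_zero order_antisym)
  then show ?thesis by (simp add: z_def)
qed

text \<open>This is the singular value decomposition. On an eigenbasis \<open>E\<close> of T^* T the
  identity <Te|Tf> = <T^* T e|f> shows that the images \<open>T e\<close> are mutually orthogonal
  and that their lengths are the singular values.\<close>

lemma abs_op_eigen:
  assumes T: "T \<in> bounded_ops"
  obtains E where "orthonormal_basis E" "positive_op (abs_op T)"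
    "\<And>e. e \<in> E \<Longrightarrow> abs_op T e = norm (T e) *\<^sub>R e"
    "\<And>e f. e \<in> E \<Longrightarrow> f \<in> E \<Longrightarrow> e \<noteq> f \<Longrightarrow> cinner (T e) (T f) = 0"
proof -
  let ?A = "adjoint_op T o\<^sub>L T"
  have A: "?A \<in> bounded_ops" using T adjoint_op_bounded by blast
  have A2: "cinner (?A x) y = cinner (T x) (T y)" for x y
    using cinner_adjoint_op[OF T, of y "T x"] by (metis blinfun_compose.rep_eq cinner_commute comp_apply)
  have "cinner (?A x) y = cinner x (?A y)" for x y
    by (metis A2 cinner_commute)
  then obtain E l where E: "orthonormal_basis E" and l: "\<And>e. e \<in> E \<Longrightarrow> ?A e = l e *\<^sub>R e"
    using spectral_theorem[of ?A] by metis
  note on = orthonormal_basisD[OF E]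
  define s where "s e = norm (T e)" for e
  have Ae: "?A e = (s e)\<^sup>2 *\<^sub>R e" if "e \<in> E" for e
  proof -
    have "complex_of_real (l e) = complex_of_real ((s e)\<^sup>2)"
      using A2[of e e] that on(2) unfolding l[OF that]
      by (simp add: scaleR_scaleC cinner_scaleC_left orthonormal_def s_def
          flip: of_real_power cinner_self)
    then show ?thesis using l[OF that] by (metis of_real_eq_iff)
  qed
  define P where "P = (\<Sum>e\<in>E. s e *\<^sub>R rank_one e e)"
  have Papp: "P x = (\<Sum>e\<in>E. (complex_of_real (s e) * cinner x e) *\<^sub>C e)" for x
    by (simp add: P_def blinfun_sum_apply blinfun.scaleR_left rank_one_apply scaleR_scaleC scaleC_scaleC)
  have P: "P \<in> bounded_ops"
    unfolding P_def by (intro bounded_ops_sum bounded_ops_scaleR bounded_ops_rank_one)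
  have Pe: "P e = s e *\<^sub>R e" if "e \<in> E" for e
  proof -
    have "P e = (\<Sum>f\<in>E. if e = f then s e *\<^sub>R e else 0)"
      unfolding Papp using on(2) that
      by (intro sum.cong) (auto simp: orthonormal_def scaleR_scaleC)
    then show ?thesis using that on(1) by simp
  qed
  have "cinner (P x) x = complex_of_real (\<Sum>e\<in>E. s e * (cmod (cinner x e))\<^sup>2)" for x
  proof -
    have "cinner (P x) x = (\<Sum>e\<in>E. complex_of_real (s e) * (cinner x e * cnj (cinner x e)))"
      by (simp add: Papp cinner_sum_left cinner_scaleC_left mult.assoc flip: cinner_commute)
    then show ?thesis by (simp flip: complex_norm_square)
  qed
  then have pos: "positive_op P"
    using P by (simp add: positive_op_def s_def sum_nonneg)
  have sq: "P o\<^sub>L P = ?A"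
    using P A by (intro bounded_ops_eqI[OF E])
      (use Ae in \<open>auto simp: Pe blinfun.scaleR_right power2_eq_square\<close>)
  \<comment> \<open>Every positive square root acts on \<open>E\<close> with the nonnegative roots
    of the eigenvalues, so it agrees with \<open>P\<close> on a basis.\<close>
  have unique: "Q = P" if Q: "positive_op Q" "Q o\<^sub>L Q = ?A" for Q
  proof (rule bounded_ops_eqI[OF E])
    show "Q \<in> bounded_ops" using Q(1) by (simp add: positive_op_def)
    fix e assume "e \<in> E"
    then have "(Q o\<^sub>L Q) e = (s e)\<^sup>2 *\<^sub>R e" unfolding Q(2) by (rule Ae)
    then have "Q (Q e) = (norm (T e))\<^sup>2 *\<^sub>R e" by (simp add: s_def)
    then show "Q e = P e"
      using positive_op_sqrt_eigen[OF Q(1) _ norm_ge_zero] Pe[OF \<open>e \<in> E\<close>] s_def by metis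
  qed (rule P)
  have "abs_op T = P"
    unfolding abs_op_def by (rule the_equality) (blast intro: pos sq unique)+
  moreover have "cinner (T e) (T f) = 0" if "e \<in> E" "f \<in> E" "e \<noteq> f" for e f
    using A2[of e f] on(2) that unfolding Ae[OF that(1)]
    by (simp add: scaleR_scaleC cinner_scaleC_left orthonormal_def)
  ultimately show ?thesis using that E pos Pe by (simp add: s_def)
qed

text \<open>The trace is taken over \<open>onb\<close>, the eigenvectors of the absolute value form
  a different basis. Expanding in the eigenbasis, swapping the sums and applying Parseval in
  \<open>onb\<close> moves the trace to the eigenbasis.\<close>

lemma trace_norm_eq_sum:
  assumes T: "T \<in> bounded_ops"
  obtains E where "orthonormal_basis E" "trace_norm T = (\<Sum>e\<in>E. norm (T e))"
    "\<And>e f. e \<in> E \<Longrightarrow> f \<in> E \<Longrightarrow> e \<noteq> f \<Longrightarrow> cinner (T e) (T f) = 0"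
proof -
  obtain E where E: "orthonormal_basis E" "positive_op (abs_op T)"
    and eig: "\<And>e. e \<in> E \<Longrightarrow> abs_op T e = norm (T e) *\<^sub>R e"
    and orth: "\<And>e f. e \<in> E \<Longrightarrow> f \<in> E \<Longrightarrow> e \<noteq> f \<Longrightarrow> cinner (T e) (T f) = 0"
    using abs_op_eigen[OF T] by metis
  have P: "abs_op T \<in> bounded_ops" using E(2) by (simp add: positive_op_def)
  have "trace_op (abs_op T) = (\<Sum>f\<in>onb. cinner (abs_op T f) f)"
    by (simp add: trace_op_def onb_def)
  also have "\<dots> = (\<Sum>f\<in>onb. \<Sum>e\<in>E. complex_of_real (norm (T e)) * (cinner f e * cinner e f))"
    by (subst bounded_ops_expansion_apply[OF E(1) P])
      (auto intro!: sum.cong simp: eig cinner_sum_left cinner_scaleC_left scaleR_scaleC)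
  also have "\<dots> = (\<Sum>e\<in>E. \<Sum>f\<in>onb. complex_of_real (norm (T e)) * (cinner e f * cinner f e))"
    by (subst sum.swap) (simp add: mult.commute)
  also have "\<dots> = (\<Sum>e\<in>E. complex_of_real (norm (T e)) * cinner e e)"
  proof (rule sum.cong[OF refl])
    fix e
    show "(\<Sum>f\<in>onb. complex_of_real (norm (T e)) * (cinner e f * cinner f e))
        = complex_of_real (norm (T e)) * cinner e e"
      by (simp only: parseval[OF orthonormal_basis_onb, of e e] sum_distrib_left)
  qed
  also have "\<dots> = complex_of_real (\<Sum>e\<in>E. norm (T e))"
    using orthonormal_basisD(2)[OF E(1)] by (simp add: orthonormal_def)
  finally have "trace_norm T = (\<Sum>e\<in>E. norm (T e))"
    by (simp add: trace_norm_def)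
  then show ?thesis using that E(1) orth by blast
qed

section \<open>Trace duality\<close>

text \<open>Bilinear over the reals only, being conjugate linear in the second argument. The
  resulting continuity carries compactness from vectors to operators.\<close>

lemma bounded_bilinear_rank_one: "bounded_bilinear (rank_one :: 'a::complex_inner \<Rightarrow> 'a \<Rightarrow> _)"
proof
  fix x x' y y' :: 'a and r :: real
  show "rank_one (x + x') y = rank_one x y + rank_one x' y"
    by (rule blinfun_eqI) (simp add: rank_one_apply blinfun.add_left scaleC_add_right)
  show "rank_one x (y + y') = rank_one x y + rank_one x y'"
    by (rule blinfun_eqI) (simp add: rank_one_apply blinfun.add_left cinner_add_right scaleC_add_left)
  show "rank_one (r *\<^sub>R x) y = r *\<^sub>R rank_one x y"
    by (rule blinfun_eqI)
      (simp add: rank_one_apply blinfun.scaleR_left scaleR_scaleC scaleC_scaleC mult.commute)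
  show "rank_one x (r *\<^sub>R y) = r *\<^sub>R rank_one x y"
    by (rule blinfun_eqI)
      (simp add: rank_one_apply blinfun.scaleR_left scaleR_scaleC scaleC_scaleC cinner_scaleC_right)
  show "\<exists>K. \<forall>x y::'a. norm (rank_one x y) \<le> norm x * norm y * K"
  proof (intro exI[of _ 1] allI)
    fix x y :: 'a
    have "norm (rank_one x y f) \<le> norm x * norm y * norm f" for f
      using mult_right_mono[OF cmod_cinner_le[of f y] norm_ge_zero[of x]]
      by (simp add: rank_one_apply norm_scaleC mult_ac)
    then show "norm (rank_one x y) \<le> norm x * norm y * 1"
      by (intro norm_blinfun_bound) simp_all
  qed
qed

lemmas bounded_linear_rank_one_left =
  bounded_bilinear.bounded_linear_left[OF bounded_bilinear_rank_one]

lemma closed_bounded_ops: "closed (bounded_ops :: ('a::complex_inner \<Rightarrow>\<^sub>L 'a) set)"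
proof -
  have "bounded_linear ((*\<^sub>C) c :: 'a \<Rightarrow> 'a)" for c
    by (rule bounded_linear_intro[where K = "cmod c"])
       (auto simp: scaleC_add_right norm_scaleC scaleR_scaleC scaleC_scaleC mult.commute)
  then have "continuous_on UNIV (\<lambda>T::'a \<Rightarrow>\<^sub>L 'a. c *\<^sub>C T x)" for c x
    by (rule bounded_linear.continuous_on) (intro continuous_intros)
  then show ?thesis
    unfolding bounded_ops_def by (intro closed_Collect_all closed_Collect_eq continuous_intros)
qed

text \<open>Provides the finite dimension bound for Caratheodory's theorem in B(H): the first factor
  runs through a real spanning set, the second through \<open>onb\<close>.\<close>

lemma bounded_ops_finite_span:
  "\<exists>B. finite B \<and> (bounded_ops :: ('a::findim_hilbert \<Rightarrow>\<^sub>L 'a) set) \<subseteq> span B"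
proof -
  obtain R :: "'a set" where R: "finite R" "span R = UNIV" using finite_real_span by blast
  let ?B = "\<Union>e\<in>onb. (\<lambda>x. rank_one x e) ` R"
  have "T \<in> span ?B" if "T \<in> bounded_ops" for T :: "'a \<Rightarrow>\<^sub>L 'a"
  proof -
    have "rank_one (T e) e \<in> span ?B" if "e \<in> onb" for e
    proof -
      have "linear (\<lambda>x. rank_one x e)"
        using bounded_linear_rank_one_left by (rule bounded_linear.linear)
      then have "span ((\<lambda>x. rank_one x e) ` R) = range (\<lambda>x. rank_one x e)"
        using R(2) by (simp add: linear_span_image)
      then show ?thesis using span_mono[of "(\<lambda>x. rank_one x e) ` R" ?B] that by auto
    qed
    then show ?thesis
      by (subst bounded_ops_expansion[OF orthonormal_basis_onb that]) (rule span_sum)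
  qed
  moreover have "finite ?B" using R(1) orthonormal_basisD(1)[OF orthonormal_basis_onb] by blast
  ultimately show ?thesis by blast
qed

text \<open>The duality pairing \<open>Re tr (VT)\<close>.\<close>

definition tr_pair :: "('a::findim_hilbert \<Rightarrow>\<^sub>L 'a) \<Rightarrow> ('a \<Rightarrow>\<^sub>L 'a) \<Rightarrow> real" where
  "tr_pair T V = (\<Sum>e\<in>onb. inner (V (T e)) e)"

lemma tr_pair_add_left: "tr_pair (S + T) V = tr_pair S V + tr_pair T V"
  by (simp add: tr_pair_def blinfun.add_left blinfun.add_right inner_add_left sum.distrib)

lemma tr_pair_scaleR_left: "tr_pair (r *\<^sub>R T) V = r * tr_pair T V"
  by (simp add: tr_pair_def blinfun.scaleR_left blinfun.scaleR_right sum_distrib_left)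

lemma tr_pair_sum_left: "tr_pair (\<Sum>i\<in>I. T i) V = (\<Sum>i\<in>I. tr_pair (T i) V)"
  by (induction I rule: infinite_finite_induct)
    (simp_all add: tr_pair_add_left, simp_all add: tr_pair_def)

lemma tr_pair_sum_right: "tr_pair T (\<Sum>i\<in>I. V i) = (\<Sum>i\<in>I. tr_pair T (V i))"
  unfolding tr_pair_def blinfun_sum_apply inner_sum_left by (rule sum.swap)

lemma tr_pair_rank_one:
  assumes "V \<in> bounded_ops"
  shows "tr_pair (rank_one x y) V = inner (V x) y"
proof -
  have "tr_pair (rank_one x y) V = Re (\<Sum>e\<in>onb. cinner (V x) e * cinner e y)"
    by (simp add: tr_pair_def rank_one_apply bounded_opsD[OF assms] cinner_scaleC_left mult.commute
        flip: Re_cinner)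
  then show ?thesis by (simp add: Re_cinner flip: parseval[OF orthonormal_basis_onb])
qed

lemma tr_pair_eq_sum:
  assumes "orthonormal_basis E" "T \<in> bounded_ops" "V \<in> bounded_ops"
  shows "tr_pair T V = (\<Sum>e\<in>E. inner (V (T e)) e)"
  by (subst bounded_ops_expansion[OF assms(1,2)])
    (simp add: tr_pair_sum_left tr_pair_rank_one[OF assms(3)])

text \<open>Separation varies the first argument of the pairing. When the varying operator is a
  splittable one, this exchange brings the pairing into the form of the trace norm duality.\<close>

lemma tr_pair_commute:
  assumes "T \<in> bounded_ops" "V \<in> bounded_ops"
  shows "tr_pair T V = tr_pair V T"
proof -
  have "tr_pair V T = (\<Sum>e\<in>onb. tr_pair V (rank_one (T e) e))"
    by (subst (1) bounded_ops_expansion[OF orthonormal_basis_onb assms(1)]) (rule tr_pair_sum_right)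
  also have "\<dots> = (\<Sum>e\<in>onb. inner (V (T e)) e)"
  proof (rule sum.cong[OF refl])
    fix e
    have "tr_pair V (rank_one (T e) e) = Re (\<Sum>f\<in>onb. cinner (T e) f * cinner (V f) e)"
      by (simp add: tr_pair_def rank_one_apply cinner_scaleC_left mult.commute flip: Re_cinner)
    also have "(\<Sum>f\<in>onb. cinner (T e) f * cinner (V f) e) = cinner (V (T e)) e"
      by (subst (2) bounded_ops_expansion_apply[OF orthonormal_basis_onb assms(2)])
        (simp add: cinner_sum_left cinner_scaleC_left)
    finally show "tr_pair V (rank_one (T e) e) = inner (V (T e)) e" by (simp add: Re_cinner)
  qed
  finally show ?thesis by (simp add: tr_pair_def)
qed

lemma rank_one_sandwich:
  assumes "A \<in> bounded_ops" "B \<in> bounded_ops"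
  shows "A o\<^sub>L rank_one x y o\<^sub>L adjoint_op B = rank_one (A x) (B y)"
proof (rule blinfun_eqI)
  fix f
  have "cinner (adjoint_op B f) y = cinner f (B y)"
    using cinner_adjoint_op[OF assms(2), of y f] by (metis cinner_commute)
  then show "(A o\<^sub>L rank_one x y o\<^sub>L adjoint_op B) f = rank_one (A x) (B y) f"
    by (simp add: rank_one_apply bounded_opsD[OF assms(1)])
qed

text \<open>Cyclicity of the trace, obtained by expanding \<open>T\<close> into rank one operators.
  It transports the duality between unweighted and weighted trace norms.\<close>

lemma tr_pair_sandwich:
  assumes "A \<in> bounded_ops" "B \<in> bounded_ops" "T \<in> bounded_ops" "W \<in> bounded_ops"
  shows "tr_pair (A o\<^sub>L T o\<^sub>L adjoint_op B) W = tr_pair T (adjoint_op B o\<^sub>L W o\<^sub>L A)"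
proof -
  note B' = adjoint_op_bounded[OF assms(2)]
  have "A o\<^sub>L T o\<^sub>L adjoint_op B = (\<Sum>e\<in>onb. A o\<^sub>L rank_one (T e) e o\<^sub>L adjoint_op B)"
  proof (rule blinfun_eqI)
    fix x
    have "A (T (adjoint_op B x)) = A ((\<Sum>e\<in>onb. rank_one (T e) e) (adjoint_op B x))"
      by (simp flip: bounded_ops_expansion[OF orthonormal_basis_onb assms(3)])
    then show "(A o\<^sub>L T o\<^sub>L adjoint_op B) x = (\<Sum>e\<in>onb. A o\<^sub>L rank_one (T e) e o\<^sub>L adjoint_op B) x"
      by (simp add: blinfun_sum_apply blinfun.sum_right)
  qed
  then have "tr_pair (A o\<^sub>L T o\<^sub>L adjoint_op B) W = (\<Sum>e\<in>onb. inner (W (A (T e))) (B e))"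
    by (simp add: rank_one_sandwich[OF assms(1,2)] tr_pair_sum_left tr_pair_rank_one[OF assms(4)])
  also have "\<dots> = (\<Sum>e\<in>onb. inner (adjoint_op B (W (A (T e)))) e)"
  proof (rule sum.cong[OF refl])
    fix e
    show "inner (W (A (T e))) (B e) = inner (adjoint_op B (W (A (T e)))) e"
      using inner_adjoint_op[OF assms(2), of e "W (A (T e))"] by (simp add: inner_commute)
  qed
  finally show ?thesis by (simp add: tr_pair_def)
qed

section \<open>Dominated operators and the dual form of the trace norm\<close>

definition dominated_ops :: "('a::complex_inner \<Rightarrow>\<^sub>L 'a) \<Rightarrow> ('a \<Rightarrow>\<^sub>L 'a) \<Rightarrow> ('a \<Rightarrow>\<^sub>L 'a) set" where
  "dominated_ops A B = {V \<in> bounded_ops. \<forall>x y. inner (V x) y \<le> norm (A x) * norm (B y)}"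

text \<open>A unimodular factor on \<open>x\<close> rotates <Vx|y> onto the nonnegative real axis
  and leaves \<open>g\<close> unchanged. Hence the real inequalities in
  \<open>dominated_ops\<close>, which visibly cut out a closed convex set, express the bounds on the
  modulus.\<close>

lemma cmod_le_iff_inner_le:
  assumes "V \<in> bounded_ops" "\<And>a x y. cmod a = 1 \<Longrightarrow> g (a *\<^sub>C x) y = g x y"
  shows "(\<forall>x y. cmod (cinner (V x) y) \<le> g x y) \<longleftrightarrow> (\<forall>x y. inner (V x) y \<le> g x y)"
proof safe
  fix x y
  assume "\<forall>x y. cmod (cinner (V x) y) \<le> g x y"
  then show "inner (V x) y \<le> g x y"
    using complex_Re_le_cmod[of "cinner (V x) y"] by (fastforce simp: Re_cinner intro: order_trans)
next
  fix x y
  assume bound: "\<forall>x y. inner (V x) y \<le> g x y"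
  obtain a where a: "cmod a = 1" "inner (a *\<^sub>C V x) y = cmod (cinner (V x) y)"
    by (rule phase_rotation)
  then have "cmod (cinner (V x) y) = inner (V (a *\<^sub>C x)) y" by (simp add: bounded_opsD[OF assms(1)])
  also have "\<dots> \<le> g x y" using bound assms(2)[OF a(1), of x y] by metis
  finally show "cmod (cinner (V x) y) \<le> g x y" .
qed

text \<open>Computed in the basis that realises the trace norm, the pairing is bounded term by term,
  as each basis vector has norm 1.\<close>

lemma trace_norm_dual_le:
  assumes "T \<in> bounded_ops" "W \<in> dominated_ops id_blinfun id_blinfun"
  shows "tr_pair T W \<le> trace_norm T"
proof -
  obtain E where E: "orthonormal_basis E" "trace_norm T = (\<Sum>e\<in>E. norm (T e))"
    using trace_norm_eq_sum[OF assms(1)] by metis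
  have "inner (W (T e)) e \<le> norm (T e)" if "e \<in> E" for e
  proof -
    have "inner (W (T e)) e \<le> norm (id_blinfun (T e)) * norm (id_blinfun e)"
      using assms(2) unfolding dominated_ops_def by blast
    then show ?thesis using orthonormal_norm[OF orthonormal_basisD(2)[OF E(1)] that] by simp
  qed
  then show ?thesis
    using assms tr_pair_eq_sum[OF E(1)] E(2) by (simp add: dominated_ops_def sum_mono)
qed

text \<open>The maximiser is the adjoint of the partial isometry in the polar decomposition.\<close>

lemma trace_norm_dual_attained:
  assumes T: "T \<in> bounded_ops"
  shows "\<exists>W \<in> dominated_ops id_blinfun id_blinfun. tr_pair T W = trace_norm T"
proof -
  obtain E where E: "orthonormal_basis E" "trace_norm T = (\<Sum>e\<in>E. norm (T e))"
    and orth: "\<And>e f. e \<in> E \<Longrightarrow> f \<in> E \<Longrightarrow> e \<noteq> f \<Longrightarrow> cinner (T e) (T f) = 0"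
    using trace_norm_eq_sum[OF T] by metis
  note on = orthonormal_basisD[OF E(1)]
  \<comment> \<open>These are the left singular vectors. Where \<open>T e\<close> = 0 the convention
    inverse 0 = 0 makes \<open>g e\<close> = 0, so the \<open>g e\<close> are orthogonal with norm 1
    or 0.\<close>
  define g where "g e = complex_of_real (inverse (norm (T e))) *\<^sub>C T e" for e
  define W where "W = (\<Sum>e\<in>E. rank_one e (g e))"
  have W: "W \<in> bounded_ops" unfolding W_def by (intro bounded_ops_sum bounded_ops_rank_one)
  have g_orth: "cinner (g e) (g f) = 0" if "e \<in> E" "f \<in> E" "e \<noteq> f" for e f
    using orth[OF that] by (simp add: g_def cinner_scaleC_left cinner_scaleC_right)
  have g_norm: "norm (g e) \<le> 1" for e
    by (cases "T e = 0") (simp_all add: g_def norm_scaleC norm_inverse)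
  have WT: "W (T e) = norm (T e) *\<^sub>R e" if "e \<in> E" for e
  proof -
    have "cinner (T e) (g f) *\<^sub>C f = (if e = f then norm (T e) *\<^sub>R e else 0)" if "f \<in> E" for f
      using orth[OF \<open>e \<in> E\<close> that]
      by (cases "T e = 0")
        (auto simp: g_def cinner_scaleC_right cinner_self scaleR_scaleC power2_eq_square field_simps)
    then show ?thesis
      using that on(1) by (simp add: W_def blinfun_sum_apply rank_one_apply)
  qed
  have "tr_pair T W = (\<Sum>e\<in>E. inner (W (T e)) e)" by (rule tr_pair_eq_sum[OF E(1) T W])
  also have "\<dots> = trace_norm T"
    unfolding E(2) using orthonormal_norm[OF on(2)]
    by (intro sum.cong) (simp_all add: WT flip: power2_norm_eq_inner)
  finally have "tr_pair T W = trace_norm T" .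
  moreover have "inner (W x) y \<le> norm x * norm y" for x y
  proof -
    \<comment> \<open>\<open>z\<close> is the adjoint of \<open>W\<close> applied to
      \<open>y\<close>; orthogonality of the \<open>g e\<close> gives ||z|| \<le> ||y||, hence the
      contraction bound for \<open>W\<close>.\<close>
    define z where "z = (\<Sum>e\<in>E. cinner y e *\<^sub>C g e)"
    have "cinner (W x) y = cinner x z"
      by (simp add: W_def z_def blinfun_sum_apply rank_one_apply cinner_sum_left cinner_sum_right
          cinner_scaleC_left cinner_scaleC_right mult.commute flip: cinner_commute[of _ y])
    then have "inner (W x) y \<le> norm x * norm z"
      by (metis Re_cinner norm_cauchy_schwarz)
    moreover have "norm z \<le> norm y"
    proof -
      have "cinner z z = (\<Sum>e\<in>E. \<Sum>f\<in>E. cinner y e * cnj (cinner y f) * cinner (g e) (g f))"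
        unfolding z_def
        by (subst sum.swap)
          (simp add: cinner_sum_left cinner_sum_right cinner_scaleC_left cinner_scaleC_right
            sum_distrib_left mult_ac)
      also have "\<dots> = (\<Sum>e\<in>E. \<Sum>f\<in>E. if e = f then complex_of_real ((cmod (cinner y e))\<^sup>2 * (norm (g e))\<^sup>2) else 0)"
        by (intro sum.cong)
          (auto simp: g_orth cinner_self complex_norm_square[symmetric] simp del: of_real_power)
      also have "\<dots> = complex_of_real (\<Sum>e\<in>E. (cmod (cinner y e))\<^sup>2 * (norm (g e))\<^sup>2)"
        using on(1) by simp
      finally have "(norm z)\<^sup>2 = (\<Sum>e\<in>E. (cmod (cinner y e))\<^sup>2 * (norm (g e))\<^sup>2)"
        unfolding cinner_self of_real_eq_iff .
      also have "\<dots> \<le> (\<Sum>e\<in>E. (cmod (cinner y e))\<^sup>2)"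
        using g_norm by (intro sum_mono mult_left_le) (auto simp: power_le_one)
      also have "\<dots> = (norm y)\<^sup>2"
      proof -
        have "complex_of_real ((norm y)\<^sup>2) = (\<Sum>e\<in>E. cinner y e * cnj (cinner y e))"
          using parseval[OF E(1), of y y] by (simp add: cinner_self flip: cinner_commute)
        then have "complex_of_real ((norm y)\<^sup>2) = complex_of_real (\<Sum>e\<in>E. (cmod (cinner y e))\<^sup>2)"
          by (simp flip: complex_norm_square)
        then show ?thesis unfolding of_real_eq_iff by simp
      qed
      finally show ?thesis by (rule power2_le_imp_le) simp
    qed
    ultimately show ?thesis by (meson mult_left_mono norm_ge_zero order_trans)
  qed
  ultimately show ?thesis using W by (auto simp: dominated_ops_def)
qed

lemma invertible_op_bounded: "invertible_op A \<Longrightarrow> A \<in> bounded_ops"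
  by (simp add: invertible_op_def)

lemma invertible_op_id: "invertible_op id_blinfun"
  unfolding invertible_op_def by (auto intro!: bexI[of _ id_blinfun] blinfun_eqI)

lemma weighted_trace_norm_dual_le:
  assumes A: "invertible_op A" and B: "invertible_op B"
    and T: "T \<in> bounded_ops" and V: "V \<in> dominated_ops A B"
  shows "tr_pair T V \<le> trace_norm (A o\<^sub>L T o\<^sub>L adjoint_op B)"
proof -
  obtain A' where A': "A' \<in> bounded_ops" "A' o\<^sub>L A = id_blinfun" "A o\<^sub>L A' = id_blinfun"
    using A by (auto simp: invertible_op_def)
  obtain B' where B': "B' \<in> bounded_ops" "B' o\<^sub>L B = id_blinfun" "B o\<^sub>L B' = id_blinfun"
    using B by (auto simp: invertible_op_def)
  have AA: "A (A' x) = x" "A' (A x) = x" and BB: "B (B' x) = x" "B' (B x) = x" for x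
    using A'(2,3) B'(2,3) by (metis blinfun_apply_blinfun_compose id_blinfun.rep_eq id_apply)+
  note bo = invertible_op_bounded[OF A] invertible_op_bounded[OF B]
  have Vb: "V \<in> bounded_ops" using V by (simp add: dominated_ops_def)
  \<comment> \<open>Invertibility enters here: compressing \<open>V\<close> by the inverses turns
    its weighted bound into the unweighted one, and B^* W A recovers \<open>V\<close>.\<close>
  define W where "W = adjoint_op B' o\<^sub>L V o\<^sub>L A'"
  have W: "W \<in> bounded_ops"
    unfolding W_def by (intro bounded_ops_compose adjoint_op_bounded Vb A' B')
  have "inner (W x) y \<le> norm x * norm y" for x y
  proof -
    have "inner (W x) y = inner (V (A' x)) (B' y)"
      using inner_adjoint_op[OF B'(1), of y "V (A' x)"] by (simp add: W_def inner_commute)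
    also have "\<dots> \<le> norm (A (A' x)) * norm (B (B' y))"
      using V by (simp add: dominated_ops_def)
    finally show ?thesis by (simp add: AA BB)
  qed
  then have W_dom: "W \<in> dominated_ops id_blinfun id_blinfun" using W by (simp add: dominated_ops_def)
  have "adjoint_op B o\<^sub>L W o\<^sub>L A = V"
  proof (rule blinfun_eqI, rule vector_eq_rdot[THEN iffD1], rule allI)
    fix x y
    have "inner ((adjoint_op B o\<^sub>L W o\<^sub>L A) x) y = inner (W (A x)) (B y)"
      using inner_adjoint_op[OF bo(2), of y "W (A x)"] by (simp add: inner_commute)
    also have "\<dots> = inner (V x) y"
      using inner_adjoint_op[OF B'(1), of "B y" "V x"] by (simp add: W_def AA BB inner_commute)
    finally show "inner ((adjoint_op B o\<^sub>L W o\<^sub>L A) x) y = inner (V x) y" .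
  qed
  then have "tr_pair T V = tr_pair (A o\<^sub>L T o\<^sub>L adjoint_op B) W"
    using tr_pair_sandwich[OF bo T W] by simp
  also have "\<dots> \<le> trace_norm (A o\<^sub>L T o\<^sub>L adjoint_op B)"
    by (intro trace_norm_dual_le bounded_ops_compose adjoint_op_bounded bo T W_dom)
  finally show ?thesis .
qed

lemma weighted_trace_norm_dual_attained:
  assumes A: "A \<in> bounded_ops" and B: "B \<in> bounded_ops" and T: "T \<in> bounded_ops"
  shows "\<exists>V \<in> dominated_ops A B. tr_pair T V = trace_norm (A o\<^sub>L T o\<^sub>L adjoint_op B)"
proof -
  have "A o\<^sub>L T o\<^sub>L adjoint_op B \<in> bounded_ops"
    by (intro bounded_ops_compose adjoint_op_bounded A B T)
  then obtain W where W: "W \<in> dominated_ops id_blinfun id_blinfun"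
      "tr_pair (A o\<^sub>L T o\<^sub>L adjoint_op B) W = trace_norm (A o\<^sub>L T o\<^sub>L adjoint_op B)"
    using trace_norm_dual_attained by blast
  have Wb: "W \<in> bounded_ops" using W by (simp add: dominated_ops_def)
  define V where "V = adjoint_op B o\<^sub>L W o\<^sub>L A"
  have "V \<in> bounded_ops" unfolding V_def by (intro bounded_ops_compose adjoint_op_bounded A B Wb)
  moreover have "inner (V x) y \<le> norm (A x) * norm (B y)" for x y
  proof -
    have "inner (V x) y = inner (W (A x)) (B y)"
      using inner_adjoint_op[OF B, of y "W (A x)"] by (simp add: V_def inner_commute)
    then show ?thesis using W(1) by (simp add: dominated_ops_def)
  qed
  ultimately have "V \<in> dominated_ops A B" by (simp add: dominated_ops_def)
  then show ?thesis using W(2) tr_pair_sandwich[OF A B T Wb] by (auto simp: V_def)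
qed

lemma convex_dominated_ops: "convex (dominated_ops A B)"
proof (rule convexI)
  fix V W and u v :: real
  assume V: "V \<in> dominated_ops A B" and W: "W \<in> dominated_ops A B" and uv: "0 \<le> u" "0 \<le> v" "u + v = 1"
  have "inner ((u *\<^sub>R V + v *\<^sub>R W) x) y \<le> norm (A x) * norm (B y)" for x y
  proof -
    have "inner ((u *\<^sub>R V + v *\<^sub>R W) x) y = u * inner (V x) y + v * inner (W x) y"
      by (simp add: blinfun.add_left blinfun.scaleR_left inner_add_left)
    also have "\<dots> \<le> norm (A x) * norm (B y)"
      using V W uv by (intro convex_bound_le) (simp_all add: dominated_ops_def)
    finally show ?thesis .
  qed
  then show "u *\<^sub>R V + v *\<^sub>R W \<in> dominated_ops A B"
    using V W by (auto simp: dominated_ops_def)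
qed

text \<open>Testing the domination with y = V e for a basis vector \<open>e\<close> gives ||V e||
  \<le> ||A|| ||B||. So every column lies in a fixed compact ball, and the set is closed.\<close>

lemma compact_dominated_ops:
  fixes A B :: "'a::findim_hilbert \<Rightarrow>\<^sub>L 'a"
  shows "compact (dominated_ops A B)"
proof -
  define r where "r = norm A * norm B"
  define X where "X e = (\<lambda>x. rank_one x e) ` cball (0::'a) r" for e
  have "compact (X e)" for e
    unfolding X_def
    by (intro compact_continuous_image linear_continuous_on bounded_linear_rank_one_left
        compact_cball_findim)
  then have "compact {\<Sum>e\<in>onb. f e | f. \<forall>e\<in>onb. f e \<in> X e}"
    using orthonormal_basisD(1)[OF orthonormal_basis_onb] by (intro compact_sum_choices)
  moreover have "dominated_ops A B \<subseteq> {\<Sum>e\<in>onb. f e | f. \<forall>e\<in>onb. f e \<in> X e}"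
  proof
    fix V assume V: "V \<in> dominated_ops A B"
    have "norm (V e) \<le> r" if "e \<in> onb" for e
    proof (cases "V e = 0")
      case False
      have "norm e = 1" using orthonormal_norm[OF orthonormal_basisD(2)[OF orthonormal_basis_onb] that] .
      then have "norm (A e) \<le> norm A" using norm_blinfun[of A e] by simp
      have "norm (V e) * norm (V e) \<le> norm (A e) * norm (B (V e))"
      proof -
        have "inner (V e) (V e) \<le> norm (A e) * norm (B (V e))"
          using V unfolding dominated_ops_def by blast
        then show ?thesis by (simp add: power2_norm_eq_inner flip: power2_eq_square)
      qed
      also have "\<dots> \<le> norm A * (norm B * norm (V e))"
        using \<open>norm (A e) \<le> norm A\<close> norm_blinfun[of B "V e"] by (intro mult_mono) auto
      finally show ?thesis using False by (simp add: r_def mult.assoc[symmetric])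
    qed (simp add: r_def)
    then show "V \<in> {\<Sum>e\<in>onb. f e | f. \<forall>e\<in>onb. f e \<in> X e}"
      using V bounded_ops_expansion[OF orthonormal_basis_onb, of V]
      by (intro CollectI exI[of _ "\<lambda>e. rank_one (V e) e"]) (auto simp: X_def dominated_ops_def)
  qed
  moreover have "closed (dominated_ops A B)"
    unfolding dominated_ops_def Collect_conj_eq Collect_mem_eq
    by (intro closed_Int closed_bounded_ops closed_Collect_all closed_Collect_le continuous_intros)
  ultimately show ?thesis by (rule compact_closed_in_compact)
qed

text \<open>Pairing with \<open>w\<^sup>*\<close> is the real Hilbert--Schmidt inner product with \<open>w\<close>; the separating
  functional is the one of \<open>w = z - p\<close>, where \<open>p\<close> is a point of \<open>S\<close> nearest to \<open>z\<close>.\<close>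

lemma tr_pair_separation:
  fixes z :: "'a::findim_hilbert \<Rightarrow>\<^sub>L 'a"
  assumes S: "compact S" "convex S" "S \<noteq> {}" "S \<subseteq> bounded_ops" and z: "z \<in> bounded_ops" "z \<notin> S"
  obtains W c where "W \<in> bounded_ops" "\<And>s. s \<in> S \<Longrightarrow> tr_pair s W \<le> c" "c < tr_pair z W"
proof -
  define h where "h U V = (\<Sum>e\<in>onb. inner (U e) (V e))" for U V :: "'a \<Rightarrow>\<^sub>L 'a"
  have h_adj: "tr_pair V (adjoint_op U) = h U V" if "U \<in> bounded_ops" for U V
    unfolding tr_pair_def h_def
    by (intro sum.cong refl) (metis inner_adjoint_op[OF that] inner_commute)
  have "continuous_on S (\<lambda>p. h (z - p) (z - p))"
    unfolding h_def by (intro continuous_intros)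
  then obtain p where p: "p \<in> S" and min: "\<And>s. s \<in> S \<Longrightarrow> h (z - p) (z - p) \<le> h (z - s) (z - s)"
    using continuous_attains_inf[OF S(1,3)] by blast
  define w where "w = z - p"
  have w: "w \<in> bounded_ops" using z(1) p S(4) by (auto simp: w_def)
  have "h w w > 0"
  proof -
    have "h w w \<ge> 0" by (simp add: h_def sum_nonneg)
    moreover have "h w w \<noteq> 0"
    proof
      assume "h w w = 0"
      then have "\<forall>e\<in>onb. inner (w e) (w e) = 0"
        unfolding h_def
        by (subst (asm) sum_nonneg_eq_0_iff[OF orthonormal_basisD(1)[OF orthonormal_basis_onb]]) simp_all
      then have "w e = (0 :: 'a \<Rightarrow>\<^sub>L 'a) e" if "e \<in> onb" for e
        using that by simp
      then have "w = 0" using w by (intro bounded_ops_eqI[OF orthonormal_basis_onb]) auto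
      then show False using z(2) p by (simp add: w_def)
    qed
    ultimately show ?thesis by simp
  qed
  have "h w s \<le> h w p" if s: "s \<in> S" for s
  proof -
    \<comment> \<open>Convexity keeps the segment from \<open>p\<close> to \<open>s\<close> inside
      \<open>S\<close>, and by minimality moving along it cannot decrease the distance to
      \<open>z\<close>.\<close>
    have "0 \<le> - h w (s - p)"
    proof (rule first_order_nonneg)
      fix t :: real assume t: "0 < t" "t \<le> 1"
      have "(1 - t) *\<^sub>R p + t *\<^sub>R s \<in> S" using S(2) p s t by (intro convexD) auto
      moreover have "z - ((1 - t) *\<^sub>R p + t *\<^sub>R s) = w - t *\<^sub>R (s - p)"
        by (simp add: w_def algebra_simps)
      ultimately have "h w w \<le> h (w - t *\<^sub>R (s - p)) (w - t *\<^sub>R (s - p))"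
        using min by (metis w_def)
      also have "\<dots> = (\<Sum>e\<in>onb. inner (w e) (w e) + 2 * t * (- inner (w e) ((s - p) e))
          + t\<^sup>2 * inner ((s - p) e) ((s - p) e))"
        unfolding h_def blinfun.diff_left blinfun.scaleR_left
        by (intro sum.cong refl)
          (simp add: inner_diff_left inner_diff_right inner_commute power2_eq_square algebra_simps)
      also have "\<dots> = h w w + 2 * t * (- h w (s - p)) + t\<^sup>2 * h (s - p) (s - p)"
        by (simp add: h_def sum.distrib sum_subtractf sum_distrib_left)
      finally show "0 \<le> 2 * t * (- h w (s - p)) + t\<^sup>2 * h (s - p) (s - p)" by simp
    qed
    then show ?thesis
      by (simp add: h_def blinfun.diff_left inner_diff_right sum_subtractf)
  qed
  moreover have "h w p < h w z"
    using \<open>h w w > 0\<close> by (simp add: h_def w_def blinfun.diff_left inner_diff_right sum_subtractf)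
  ultimately show ?thesis
    using that[of "adjoint_op w" "h w p"] adjoint_op_bounded[OF w] h_adj[OF w] by simp
qed

section \<open>Polar sets\<close>

text \<open>The index \<open>j\<close> carries the plain term ||x|| ||y|| as identity weights, so
  that all terms are handled alike.\<close>

locale weights =
  fixes I :: "'i set" and A B :: "'i \<Rightarrow> 'a::findim_hilbert \<Rightarrow>\<^sub>L 'a" and j :: 'i
  assumes finite_I: "finite I"
    and j: "j \<in> I" "A j = id_blinfun" "B j = id_blinfun"
    and invertible_A: "\<And>i. i \<in> I \<Longrightarrow> invertible_op (A i)"
    and invertible_B: "\<And>i. i \<in> I \<Longrightarrow> invertible_op (B i)"
begin

definition majorant :: "'a \<Rightarrow> 'a \<Rightarrow> real" where
  "majorant x y = (\<Sum>i\<in>I. norm (A i x) * norm (B i y))"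

definition total_norm :: "('a \<Rightarrow>\<^sub>L 'a) \<Rightarrow> real" where
  "total_norm T = (\<Sum>i\<in>I. trace_norm (A i o\<^sub>L T o\<^sub>L adjoint_op (B i)))"

definition splittable :: "('a \<Rightarrow>\<^sub>L 'a) set" where
  "splittable = {\<Sum>i\<in>I. V i | V. \<forall>i\<in>I. V i \<in> dominated_ops (A i) (B i)}"

definition K :: "('a \<Rightarrow>\<^sub>L 'a) set" where
  "K = {rank_one x y | x y. majorant x y \<le> 1}"

definition Delta :: "('a \<Rightarrow>\<^sub>L 'a) set" where
  "Delta = {T \<in> bounded_ops. total_norm T \<le> 1}"

lemma total_norm_dual_le:
  assumes "T \<in> bounded_ops" "V \<in> splittable"
  shows "tr_pair T V \<le> total_norm T"
proof -
  obtain W where W: "V = (\<Sum>i\<in>I. W i)" "\<forall>i\<in>I. W i \<in> dominated_ops (A i) (B i)"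
    using assms(2) by (auto simp: splittable_def)
  then show ?thesis
    unfolding W(1) tr_pair_sum_right total_norm_def
    by (intro sum_mono weighted_trace_norm_dual_le invertible_A invertible_B assms(1)) auto
qed

lemma total_norm_dual_attained:
  assumes T: "T \<in> bounded_ops"
  shows "\<exists>V \<in> splittable. tr_pair T V = total_norm T"
proof -
  have "\<forall>i\<in>I. \<exists>V \<in> dominated_ops (A i) (B i).
      tr_pair T V = trace_norm (A i o\<^sub>L T o\<^sub>L adjoint_op (B i))"
    using weighted_trace_norm_dual_attained[OF _ _ T] invertible_A invertible_B invertible_op_bounded
    by blast
  then obtain V where V: "\<forall>i\<in>I. V i \<in> dominated_ops (A i) (B i)"
      "\<forall>i\<in>I. tr_pair T (V i) = trace_norm (A i o\<^sub>L T o\<^sub>L adjoint_op (B i))"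
    by metis
  then have "(\<Sum>i\<in>I. V i) \<in> splittable" by (auto simp: splittable_def)
  moreover have "tr_pair T (\<Sum>i\<in>I. V i) = total_norm T"
    using V(2) by (simp add: tr_pair_sum_right total_norm_def)
  ultimately show ?thesis by blast
qed

lemma splittable_bounded_ops: "splittable \<subseteq> bounded_ops"
  by (auto simp: splittable_def dominated_ops_def intro!: bounded_ops_sum)

lemma splittable_le_majorant:
  assumes "V \<in> splittable"
  shows "inner (V x) y \<le> majorant x y"
  using assms
  by (auto simp: splittable_def dominated_ops_def majorant_def blinfun_sum_apply inner_sum_left
      intro!: sum_mono)

lemma compact_splittable: "compact splittable"
  unfolding splittable_def using finite_I by (intro compact_sum_choices compact_dominated_ops)

lemma convex_splittable: "convex splittable"
  unfolding splittable_def by (intro convex_sum_choices convex_dominated_ops)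

lemma zero_splittable: "0 \<in> splittable"
  unfolding splittable_def
  by (intro CollectI exI[of _ "\<lambda>_. 0"]) (simp add: dominated_ops_def)

lemma total_norm_nonneg: "T \<in> bounded_ops \<Longrightarrow> 0 \<le> total_norm T"
  using total_norm_dual_le[OF _ zero_splittable, of T] by (simp add: tr_pair_def)

text \<open>A maximiser for the combination is merely a competitor for each summand.\<close>

lemma total_norm_convex_comb:
  assumes "S \<in> bounded_ops" "T \<in> bounded_ops" "0 \<le> u" "0 \<le> v"
  shows "total_norm (u *\<^sub>R S + v *\<^sub>R T) \<le> u * total_norm S + v * total_norm T"
proof -
  obtain V where V: "V \<in> splittable" "tr_pair (u *\<^sub>R S + v *\<^sub>R T) V = total_norm (u *\<^sub>R S + v *\<^sub>R T)"
    using total_norm_dual_attained[of "u *\<^sub>R S + v *\<^sub>R T"] assms by blast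
  then have "total_norm (u *\<^sub>R S + v *\<^sub>R T) = u * tr_pair S V + v * tr_pair T V"
    by (simp add: tr_pair_add_left tr_pair_scaleR_left)
  also have "\<dots> \<le> u * total_norm S + v * total_norm T"
    using assms V(1) by (intro add_mono mult_left_mono total_norm_dual_le)
  finally show ?thesis .
qed

lemma convex_Delta: "convex Delta"
proof (rule convexI)
  fix S T and u v :: real
  assume S: "S \<in> Delta" and T: "T \<in> Delta" and uv: "0 \<le> u" "0 \<le> v" "u + v = 1"
  have "total_norm (u *\<^sub>R S + v *\<^sub>R T) \<le> u * total_norm S + v * total_norm T"
    using S T uv by (intro total_norm_convex_comb) (auto simp: Delta_def)
  also have "\<dots> \<le> 1" using S T uv by (intro convex_bound_le) (auto simp: Delta_def)
  finally show "u *\<^sub>R S + v *\<^sub>R T \<in> Delta"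
    using S T by (auto simp: Delta_def)
qed

text \<open>For a rank one operator the pairing with a maximiser \<open>V\<close> is the real part
  of <Vx|y>, which is below the majorant since \<open>V\<close> is splittable.\<close>

lemma K_subset_Delta: "K \<subseteq> Delta"
proof -
  have "total_norm (rank_one x y) \<le> majorant x y" for x y
  proof -
    obtain V where "V \<in> splittable" "tr_pair (rank_one x y) V = total_norm (rank_one x y)"
      using total_norm_dual_attained[OF bounded_ops_rank_one] by blast
    then show ?thesis
      using tr_pair_rank_one[of V x y] splittable_le_majorant[of V x y] splittable_bounded_ops by auto
  qed
  then show ?thesis by (fastforce simp: K_def Delta_def intro: order_trans)
qed

lemma majorant_scaleR: "majorant (r *\<^sub>R x) y = \<bar>r\<bar> * majorant x y" "majorant x (r *\<^sub>R y) = \<bar>r\<bar> * majorant x y"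
  by (simp_all add: majorant_def blinfun.scaleR_right sum_distrib_left mult_ac)

lemma majorant_nonneg: "0 \<le> majorant x y"
  by (simp add: majorant_def sum_nonneg)

lemma norm_le_majorant: "norm x * norm y \<le> majorant x y"
  unfolding majorant_def using member_le_sum[of j I "\<lambda>i. norm (A i x) * norm (B i y)"] finite_I j
  by simp

text \<open>The factors of a rank one operator are unbounded because of the rescaling (r x, y / r).
  Moving the length of \<open>y\<close> to \<open>x\<close> makes \<open>y\<close> a unit vector,
  and \<open>norm_le_majorant\<close> then bounds \<open>x\<close>; the zero operator is represented
  by (0, 0).\<close>

lemma compact_K: "compact K"
proof -
  define P where "P = {z. majorant (fst z) (snd z) \<le> 1} \<inter> (cball (0::'a) 1 \<times> cball (0::'a) 1)"
  have "K = (\<lambda>z. rank_one (fst z) (snd z)) ` P"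
  proof
    show "(\<lambda>z. rank_one (fst z) (snd z)) ` P \<subseteq> K" by (auto simp: K_def P_def)
    show "K \<subseteq> (\<lambda>z. rank_one (fst z) (snd z)) ` P"
    proof
      fix T assume "T \<in> K"
      then obtain x y where T: "T = rank_one x y" and g: "majorant x y \<le> 1" by (auto simp: K_def)
      show "T \<in> (\<lambda>z. rank_one (fst z) (snd z)) ` P"
      proof (cases "y = 0")
        case True
        have "T = rank_one 0 0"
          by (rule blinfun_eqI) (simp add: T True rank_one_apply)
        then show ?thesis by (intro image_eqI[of _ _ "(0, 0)"]) (auto simp: P_def majorant_def)
      next
        case False
        let ?x = "norm y *\<^sub>R x" and ?y = "(1 / norm y) *\<^sub>R y"
        have "T = rank_one ?x ?y"
          using False bounded_bilinear.scaleR_left[OF bounded_bilinear_rank_one, of "norm y" x ?y]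
            bounded_bilinear.scaleR_right[OF bounded_bilinear_rank_one, of x "1 / norm y" y]
          by (simp add: T)
        moreover have "majorant ?x ?y = majorant x y" using False by (simp add: majorant_scaleR)
        moreover have "norm ?x \<le> 1" using norm_le_majorant[of x y] g by (simp add: mult.commute)
        ultimately show ?thesis using False g
          by (intro image_eqI[of _ _ "(?x, ?y)"]) (auto simp: P_def)
      qed
    qed
  qed
  moreover have "compact P"
  proof -
    have "closed {z. majorant (fst z) (snd z) \<le> 1}"
      unfolding majorant_def by (intro closed_Collect_le continuous_intros)
    then show ?thesis
      unfolding P_def Int_commute[of "{z. majorant (fst z) (snd z) \<le> 1}"]
      by (intro compact_Int_closed compact_Times compact_cball_findim)
  qed
  moreover have "continuous_on P (\<lambda>z. rank_one (fst z) (snd z))"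
    by (intro bounded_bilinear.continuous_on[OF bounded_bilinear_rank_one] continuous_intros)
  ultimately show ?thesis by (simp add: compact_continuous_image)
qed

lemma compact_convex_hull_K: "compact (convex hull K)"
proof -
  obtain R :: "('a \<Rightarrow>\<^sub>L 'a) set" where "finite R" "bounded_ops \<subseteq> span R"
    using bounded_ops_finite_span by blast
  moreover have "K \<subseteq> bounded_ops" using K_subset_Delta by (auto simp: Delta_def)
  ultimately show ?thesis using compact_convex_hull_span[OF _ _ compact_K] by blast
qed

lemma zero_in_K: "0 \<in> K"
proof -
  have "(0 :: 'a \<Rightarrow>\<^sub>L 'a) = rank_one 0 0" by (rule blinfun_eqI) (simp add: rank_one_apply)
  moreover have "majorant 0 0 \<le> 1" by (simp add: majorant_def)
  ultimately show ?thesis unfolding K_def by blast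
qed

text \<open>Both sides scale alike in \<open>x\<close>, so it suffices to normalise the majorant to
  1. If it vanishes, the plain term forces \<open>x\<close> or \<open>y\<close> to be 0.\<close>

lemma polar_K:
  assumes U: "U \<in> bounded_ops" and "0 \<le> c"
  shows "(\<forall>T\<in>K. tr_pair T U \<le> c) \<longleftrightarrow> (\<forall>x y. inner (U x) y \<le> c * majorant x y)"
proof
  assume K: "\<forall>T\<in>K. tr_pair T U \<le> c"
  show "\<forall>x y. inner (U x) y \<le> c * majorant x y"
  proof (intro allI)
    fix x y
    show "inner (U x) y \<le> c * majorant x y"
    proof (cases "majorant x y = 0")
      case True
      then have "norm x * norm y = 0" using norm_le_majorant[of x y]
        by (metis mult_nonneg_nonneg norm_ge_zero order_antisym)
      then have "inner (U x) y = 0" by auto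
      then show ?thesis using True by simp
    next
      case False
      then have g: "majorant x y > 0" using majorant_nonneg[of x y] by simp
      have "majorant ((1 / majorant x y) *\<^sub>R x) y = 1" using g by (subst majorant_scaleR(1)) simp
      then have "majorant ((1 / majorant x y) *\<^sub>R x) y \<le> 1" by (rule eq_refl)
      then have "rank_one ((1 / majorant x y) *\<^sub>R x) y \<in> K"
        unfolding K_def by blast
      then have "inner (U ((1 / majorant x y) *\<^sub>R x)) y \<le> c"
        using K tr_pair_rank_one[OF U] by metis
      then show ?thesis using g by (simp add: blinfun.scaleR_right pos_divide_le_eq)
    qed
  qed
next
  assume bound: "\<forall>x y. inner (U x) y \<le> c * majorant x y"
  have "inner (U x) y \<le> c" if "majorant x y \<le> 1" for x y
    using bound mult_left_mono[OF that \<open>0 \<le> c\<close>] by (metis mult.right_neutral order_trans)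
  then show "\<forall>T\<in>K. tr_pair T U \<le> c"
    by (auto simp: K_def tr_pair_rank_one[OF U])
qed

theorem splitting_iff_convex_hull:
  "(\<forall>U\<in>bounded_ops. (\<forall>x y. inner (blinfun_apply U x) y \<le> majorant x y) \<longrightarrow> U \<in> splittable)
    \<longleftrightarrow> convex hull K = Delta"
proof
  assume split: "\<forall>U\<in>bounded_ops. (\<forall>x y. inner (blinfun_apply U x) y \<le> majorant x y) \<longrightarrow> U \<in> splittable"
  have "T \<in> convex hull K" if T: "T \<in> Delta" for T
  proof (rule ccontr)
    assume notin: "T \<notin> convex hull K"
    have T': "T \<in> bounded_ops" "total_norm T \<le> 1" using T by (auto simp: Delta_def)
    have "convex hull K \<subseteq> bounded_ops"
      using hull_minimal[of K Delta convex, OF K_subset_Delta convex_Delta] by (auto simp: Delta_def)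
    moreover have "convex hull K \<noteq> {}" using zero_in_K hull_inc by fastforce
    ultimately obtain W c where W: "W \<in> bounded_ops"
      and le: "\<And>S. S \<in> convex hull K \<Longrightarrow> tr_pair S W \<le> c" and gt: "c < tr_pair T W"
      using tr_pair_separation[OF compact_convex_hull_K convex_convex_hull _ _ T'(1) notin] by metis
    have "0 \<le> c" using le[OF hull_inc[OF zero_in_K]] by (simp add: tr_pair_def)
    \<comment> \<open>The constant \<open>c\<close> is nonnegative but may be 0. A strictly larger
      \<open>d\<close> can be divided by, and W / d satisfies the hypothesis of the splitting while
      its pairing with \<open>T\<close> still exceeds 1.\<close>
    obtain d where d: "c < d" "d < tr_pair T W" using gt dense by blast
    have "inner (W x) y \<le> c * majorant x y" for x y
      using polar_K[OF W \<open>0 \<le> c\<close>] le hull_inc by metis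
    moreover have "c * majorant x y \<le> d * majorant x y" for x y
      using d majorant_nonneg by (intro mult_right_mono) auto
    ultimately have "inner (W x) y \<le> d * majorant x y" for x y by (meson order_trans)
    then have "inner (((1 / d) *\<^sub>R W) x) y \<le> majorant x y" for x y
      using d \<open>0 \<le> c\<close> by (simp add: blinfun.scaleR_left pos_divide_le_eq mult.commute)
    then have "(1 / d) *\<^sub>R W \<in> splittable" using split W by blast
    then have "tr_pair T ((1 / d) *\<^sub>R W) \<le> 1"
      using total_norm_dual_le[OF T'(1)] T'(2) by fastforce
    moreover have "tr_pair T ((1 / d) *\<^sub>R W) = tr_pair T W / d"
      using tr_pair_commute[OF T'(1) W] tr_pair_commute[OF T'(1) bounded_ops_scaleR[OF W]]
      by (simp add: tr_pair_scaleR_left)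
    ultimately show False using d \<open>0 \<le> c\<close> by (simp add: pos_divide_le_eq)
  qed
  then show "convex hull K = Delta"
    using hull_minimal[of K Delta convex, OF K_subset_Delta convex_Delta] by blast
next
  assume hull: "convex hull K = Delta"
  show "\<forall>U\<in>bounded_ops. (\<forall>x y. inner (blinfun_apply U x) y \<le> majorant x y) \<longrightarrow> U \<in> splittable"
  proof (intro ballI impI, rule ccontr)
    fix U assume U: "U \<in> bounded_ops" and bound: "\<forall>x y. inner (U x) y \<le> majorant x y"
      and notin: "U \<notin> splittable"
    obtain T c where T: "T \<in> bounded_ops" and le: "\<And>V. V \<in> splittable \<Longrightarrow> tr_pair V T \<le> c"
      and gt: "c < tr_pair U T"
      using tr_pair_separation[OF compact_splittable convex_splittable _ splittable_bounded_ops U notin]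
        zero_splittable by (metis empty_iff)
    have "total_norm T \<le> c"
      using total_norm_dual_attained[OF T] le tr_pair_commute[OF T] splittable_bounded_ops
      by (metis subsetD)
    obtain d where d: "c < d" "d < tr_pair U T" using gt dense by blast
    have d0: "0 < d" using total_norm_nonneg[OF T] \<open>total_norm T \<le> c\<close> d by linarith
    \<comment> \<open>Scaling appears as a combination with the zero operator with coefficient
      0.\<close>
    have "total_norm ((1 / d) *\<^sub>R T) \<le> (1 / d) * total_norm T"
      using total_norm_convex_comb[OF T bounded_ops_zero, of "1 / d" 0] d0 by simp
    also have "\<dots> \<le> 1" using \<open>total_norm T \<le> c\<close> d d0 by simp
    finally have "(1 / d) *\<^sub>R T \<in> convex hull K" using T by (auto simp: hull Delta_def)
    \<comment> \<open>The bound on \<open>U\<close> puts \<open>K\<close>, and so its hull, into a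
      half-space that T / d violates, because its pairing with \<open>U\<close> exceeds 1.\<close>
    moreover have "convex hull K \<subseteq> {S. tr_pair S U \<le> 1}"
    proof (rule hull_minimal)
      show "K \<subseteq> {S. tr_pair S U \<le> 1}" using polar_K[OF U, of 1] bound by auto
      show "convex {S. tr_pair S U \<le> 1}"
        by (rule convexI) (auto simp: tr_pair_add_left tr_pair_scaleR_left intro!: convex_bound_le)
    qed
    ultimately have "tr_pair T U / d \<le> 1" by (auto simp: tr_pair_scaleR_left)
    then show False using d d0 tr_pair_commute[OF U T] by (simp add: pos_divide_le_eq)
  qed
qed

end

section \<open>Return to the indices 1, ..., n\<close>

lemma split_first_term:
  fixes f :: "nat \<Rightarrow> 'b::comm_monoid_add"
  assumes "n \<ge> 1"
  shows "(\<Sum>i=1..n. if i = 1 then a else f i) = a + (\<Sum>i=2..n. f i)"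
proof -
  have "(\<Sum>i=1..n. if i = 1 then a else f i) = a + (\<Sum>i\<in>{Suc 1..n}. if i = 1 then a else f i)"
    using assms by (simp add: sum.atLeast_Suc_atMost)
  also have "(\<Sum>i\<in>{Suc 1..n}. if i = 1 then a else f i) = (\<Sum>i=2..n. f i)"
    by (intro sum.cong) auto
  finally show ?thesis .
qed

text \<open>Condition (b) does not mention U, and U = 0 splits for any weights; so (a) is read as a
  statement about all U that satisfy the assumed bound.\<close>

theorem theorem2p2:
  fixes A B :: "nat \<Rightarrow> ('a::findim_hilbert \<Rightarrow>\<^sub>L 'a)" and n :: nat
  assumes "n \<ge> 1"
    and "\<And>i. i \<in> {2..n} \<Longrightarrow> invertible_op (A i)"
    and "\<And>i. i \<in> {2..n} \<Longrightarrow> invertible_op (B i)"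
  shows
    "(\<forall>U :: 'a \<Rightarrow>\<^sub>L 'a. U \<in> bounded_ops \<longrightarrow>
        (\<forall>x y. cmod (cinner (U x) y)
                \<le> norm x * norm y + (\<Sum>i=2..n. norm (A i x) * norm (B i y))) \<longrightarrow>
        (\<exists>V :: nat \<Rightarrow> ('a \<Rightarrow>\<^sub>L 'a).
            (\<forall>i\<in>{1..n}. V i \<in> bounded_ops) \<and>
            U = (\<Sum>i=1..n. V i) \<and>
            (\<forall>x y. cmod (cinner (V 1 x) y) \<le> norm x * norm y) \<and>
            (\<forall>i\<in>{2..n}. \<forall>x y. cmod (cinner (V i x) y) \<le> norm (A i x) * norm (B i y))))
     \<longleftrightarrow>
     convex hull {rank_one x y | x y.
        norm x * norm y + (\<Sum>i=2..n. norm (A i x) * norm (B i y)) \<le> 1}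
     = {T \<in> bounded_ops.
        trace_norm T
        + (\<Sum>i=2..n. trace_norm (A i o\<^sub>L T o\<^sub>L adjoint_op (B i))) \<le> 1}"
proof -
  define A' where "A' i = (if i = 1 then id_blinfun else A i)" for i
  define B' where "B' i = (if i = 1 then id_blinfun else B i)" for i
  have A'B': "invertible_op (A' i)" "invertible_op (B' i)" if "i \<in> {1..n}" for i
    using that assms(2,3)[of i] by (auto simp: A'_def B'_def invertible_op_id)
  then interpret weights "{1..n}" A' B' 1
    using assms(1) by unfold_locales (auto simp: A'_def B'_def)
  have adj_id: "adjoint_op id_blinfun = (id_blinfun :: 'a \<Rightarrow>\<^sub>L 'a)"
  proof (rule blinfun_eqI, rule vector_eq_ldot[THEN iffD1], rule allI)
    fix y z :: 'a
    show "inner z (adjoint_op id_blinfun y) = inner z (id_blinfun y)"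
      using inner_adjoint_op[OF bounded_ops_id, of z y] by simp
  qed
  have g: "majorant x y = norm x * norm y + (\<Sum>i=2..n. norm (A i x) * norm (B i y))" for x y
  proof -
    have "majorant x y = (\<Sum>i=1..n. if i = 1 then norm x * norm y else norm (A i x) * norm (B i y))"
      unfolding majorant_def by (intro sum.cong) (auto simp: A'_def B'_def)
    also note split_first_term[OF assms(1)]
    finally show ?thesis .
  qed
  have N: "total_norm T = trace_norm T + (\<Sum>i=2..n. trace_norm (A i o\<^sub>L T o\<^sub>L adjoint_op (B i)))" for T
  proof -
    have "id_blinfun o\<^sub>L T o\<^sub>L id_blinfun = T" by (rule blinfun_eqI) simp
    have "total_norm T = (\<Sum>i=1..n. if i = 1 then trace_norm T
        else trace_norm (A i o\<^sub>L T o\<^sub>L adjoint_op (B i)))"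
      unfolding total_norm_def
      by (intro sum.cong) (auto simp: A'_def B'_def adj_id \<open>id_blinfun o\<^sub>L T o\<^sub>L id_blinfun = T\<close>)
    also note split_first_term[OF assms(1)]
    finally show ?thesis .
  qed
  \<comment> \<open>Complex-linearity makes each weighted norm invariant under phases; this is what
    permits the passage from moduli to real parts.\<close>
  have rotate: "norm (T (a *\<^sub>C x)) = norm (T x)"
    if "cmod a = 1" "T \<in> bounded_ops" for a x and T :: "'a \<Rightarrow>\<^sub>L 'a"
    using that by (simp add: bounded_opsD norm_scaleC)
  have A'b: "A' i \<in> bounded_ops" if "i \<in> {1..n}" for i
    using A'B'(1)[OF that] by (rule invertible_op_bounded)
  have bound: "(\<forall>x y. cmod (cinner (U x) y) \<le> majorant x y) \<longleftrightarrow> (\<forall>x y. inner (U x) y \<le> majorant x y)"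
    if "U \<in> bounded_ops" for U :: "'a \<Rightarrow>\<^sub>L 'a"
  proof (rule cmod_le_iff_inner_le[OF that])
    fix a x y assume "cmod a = 1"
    then show "majorant (a *\<^sub>C x) y = majorant x y"
      unfolding majorant_def using A'b by (intro sum.cong) (simp_all add: rotate)
  qed
  have dom: "V \<in> dominated_ops (A' i) (B' i) \<longleftrightarrow>
      V \<in> bounded_ops \<and> (\<forall>x y. cmod (cinner (V x) y) \<le> norm (A' i x) * norm (B' i y))"
    if "i \<in> {1..n}" for i and V :: "'a \<Rightarrow>\<^sub>L 'a"
    unfolding dominated_ops_def
    using cmod_le_iff_inner_le[of V "\<lambda>x y. norm (A' i x) * norm (B' i y)"] rotate A'b[OF that] by auto
  have range: "{1..n} = insert 1 {2..n}" using assms(1) by auto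
  have split: "U \<in> splittable \<longleftrightarrow> (\<exists>V :: nat \<Rightarrow> 'a \<Rightarrow>\<^sub>L 'a.
      (\<forall>i\<in>{1..n}. V i \<in> bounded_ops) \<and> U = (\<Sum>i=1..n. V i) \<and>
      (\<forall>x y. cmod (cinner (V 1 x) y) \<le> norm x * norm y) \<and>
      (\<forall>i\<in>{2..n}. \<forall>x y. cmod (cinner (V i x) y) \<le> norm (A i x) * norm (B i y)))" for U :: "'a \<Rightarrow>\<^sub>L 'a"
  proof -
    have dom_all: "(\<forall>i\<in>{1..n}. V i \<in> dominated_ops (A' i) (B' i)) \<longleftrightarrow>
        (\<forall>i\<in>{1..n}. V i \<in> bounded_ops) \<and>
        (\<forall>x y. cmod (cinner (V 1 x) y) \<le> norm x * norm y) \<and>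
        (\<forall>i\<in>{2..n}. \<forall>x y. cmod (cinner (V i x) y) \<le> norm (A i x) * norm (B i y))" for V :: "nat \<Rightarrow> 'a \<Rightarrow>\<^sub>L 'a"
    proof -
      have "(\<forall>i\<in>{1..n}. V i \<in> dominated_ops (A' i) (B' i)) \<longleftrightarrow> (\<forall>i\<in>{1..n}. V i \<in> bounded_ops) \<and>
          (\<forall>i\<in>{1..n}. \<forall>x y. cmod (cinner (V i x) y) \<le> norm (A' i x) * norm (B' i y))"
        using dom by blast
      also have "(\<forall>i\<in>{1..n}. \<forall>x y. cmod (cinner (V i x) y) \<le> norm (A' i x) * norm (B' i y)) \<longleftrightarrow>
          (\<forall>x y. cmod (cinner (V 1 x) y) \<le> norm x * norm y) \<and>
          (\<forall>i\<in>{2..n}. \<forall>x y. cmod (cinner (V i x) y) \<le> norm (A i x) * norm (B i y))"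
        unfolding range by (auto simp: A'_def B'_def)
      finally show ?thesis .
    qed
    show ?thesis
      unfolding splittable_def mem_Collect_eq dom_all by (intro iff_exI) (rule conj_left_commute)
  qed
  have "(\<forall>U :: 'a \<Rightarrow>\<^sub>L 'a. U \<in> bounded_ops \<longrightarrow>
        (\<forall>x y. cmod (cinner (U x) y) \<le> majorant x y) \<longrightarrow> U \<in> splittable)
      \<longleftrightarrow> (\<forall>U\<in>bounded_ops. (\<forall>x y. inner (blinfun_apply U x) y \<le> majorant x y) \<longrightarrow> U \<in> splittable)"
    unfolding Ball_def
    by (rule iff_allI, rule imp_cong[OF refl], rule imp_cong[OF _ refl], rule bound)
  also have "\<dots> \<longleftrightarrow> convex hull {rank_one x y | x y. majorant x y \<le> 1}
      = {T \<in> bounded_ops. total_norm T \<le> 1}"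
    using splitting_iff_convex_hull unfolding K_def Delta_def .
  finally show ?thesis unfolding split g N .
qed

end
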